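(* Let $N\in\mathbb{N}=\{1,2,3,\dots\}$ and $s\in\mathbb{C}$ with $\Re s>0$. For $a\in\mathbb{C}$ with $\Re a>1$ and $z\in\mathbb{C}\setminus(-\infty,0]$, define $R_N(z,s,a)$ by $$F(z,s,a)=\sum_{n=0}^{N-1}C_n(z,a)\,\frac{(s)_n}{a^{n+s}}+R_N(z,s,a),$$ where $F$ is the function $\Phi(z,s,a)-z^{-a}\mathrm{Li}_s(z)$ (continued analytically in $z$) and $C_n(z,a)$ are the coefficients, both defined in the context. (i) For every fixed real $z>1$, $$R_N(z,s,a)=\mathcal{O}\!\left((\Re a)^{1-N-s}+a\,z^{-\Re a}\right)\qquad\text{as }\Re a\to\infty,$$ that is, $|R_N(z,s,a)|\le K\left((\Re a)^{1-N-\Re s}+|a|\,z^{-\Re a}\right)$ for all sufficiently large $\Re a$, where $K$ does not depend on $\Re a$ (it may depend on $N,z,s$ and $\Im a$). (ii) For every real $z\ge 1$ and every integer $m\ge 2$, the expansion with $a=m$ is convergent: $R_N(z,s,m)\to 0$ as $N\to\infty$, and $$F(z,s,m)=-\frac{1}{z^m}\sum_{k=1}^{m-1}\frac{z^k}{k^s}=\sum_{n=0}^{\infty}C_n(z,m)\,\frac{(s)_n}{m^{n+s}}.$$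
   Context: Powers use principal values. $(s)_n=s(s+1)\cdots(s+n-1)$, $(s)_0=1$, is the Pochhammer symbol. Lerch's transcendent is $\Phi(z,s,a)=\sum_{n=0}^\infty z^n/(a+n)^s$ for $|z|<1$, $a\neq 0,-1,-2,\dots$, and is defined by analytic continuation elsewhere; the polylogarithm is $\mathrm{Li}_s(z)=\sum_{n=1}^\infty z^n/n^s$ for $|z|<1$, and is defined by analytic continuation elsewhere. The function $f$ is $$f(z,x,a)=\frac{1-(ze^{-x})^{1-a}}{1-ze^{-x}},$$ with removable singularities (at $x=\log z$ for real $z\ge1$) removed, and where $(ze^{-x})^{1-a}=z^{1-a}e^{(a-1)x}$. The function $F(z,s,a)=\Phi(z,s,a)-\mathrm{Li}_s(z)/z^a$ (for $|z|<1$, $z\notin(-\infty,0]$) is continued analytically in $z$ to $\mathbb{C}\setminus(-\infty,0]$; for $\Re a>1$ and $\Re s>0$ this continuation, and in particular the value of $F$ for real $z\ge 1$, is given by $$F(z,s,a)=\frac{1}{\Gamma(s)}\int_0^\infty x^{s-1}e^{-ax}f(z,x,a)\,dx .$$ The coefficients $C_n(z,a)$ are the Taylor coefficients of $f(z,x,a)$ at $x=0$, i.e. $f(z,x,a)=\sum_{n\ge0}C_n(z,a)x^n$ near $x=0$. Explicitly, for $z\ne1$, $$C_n(z,a)=c_n(z)-z^{1-a}p_n(z,a),\qquad p_n(z,a)=\sum_{k=0}^n\frac{c_{n-k}(z)}{k!}(a-1)^k,$$ with $c_0(z)=(1-z)^{-1}$ and $c_n(z)=(-1)^n\mathrm{Li}_{-n}(z)/n!$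 for $n\ge1$, where $\mathrm{Li}_{-n}(z)=\left(z\frac{d}{dz}\right)^n\frac{z}{1-z}$. For $z=1$, $C_0(1,a)=1-a$ and, for $n\ge1$, $$C_n(1,a)=\frac{B_{n+1}-B_{n+1}(a-1)-(n+1)(a-1)^n}{(n+1)!},$$ with $B_n(\cdot)$ the Bernoulli polynomials and $B_n=B_n(0)$ the Bernoulli numbers. *)

theory Defs
  imports "HOL-Complex_Analysis.Complex_Analysis"
begin

text \<open>
  The function \<open>lerch_F\<close> below is continued from its values on the open unit disc minus
  \<open>\<real>\<^sub>\<le>\<^sub>0\<close>, so only the defining power series of Lerch's transcendent and of the polylogarithm
  are needed; they carry their intended meaning for \<open>norm z < 1\<close>.
\<close>

definition lerch_series :: "complex \<Rightarrow> complex \<Rightarrow> complex \<Rightarrow> complex" where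
  "lerch_series z s a = (\<Sum>n. z ^ n / (a + of_nat n) powr s)"

definition polylog_series :: "complex \<Rightarrow> complex \<Rightarrow> complex" where
  "polylog_series s z = (\<Sum>n. z ^ Suc n / of_nat (Suc n) powr s)"

definition is_lerch_F_continuation :: "complex \<Rightarrow> complex \<Rightarrow> (complex \<Rightarrow> complex) \<Rightarrow> bool" where
  "is_lerch_F_continuation s a g \<longleftrightarrow>
     g holomorphic_on (- \<real>\<^sub>\<le>\<^sub>0) \<and>
     (\<forall>z. norm z < 1 \<and> z \<notin> \<real>\<^sub>\<le>\<^sub>0 \<longrightarrow>
        g z = lerch_series z s a - polylog_series s z / z powr a)"

text \<open>
  By the identity theorem two continuations agree on the (connected) slit plane, so the choice
  below is immaterial there. Nothing is prescribed on the cut, which is why \<open>SOME\<close> and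
  not \<open>THE\<close> is used.
\<close>

definition lerch_F :: "complex \<Rightarrow> complex \<Rightarrow> complex \<Rightarrow> complex" where
  "lerch_F z s a = (SOME g. is_lerch_F_continuation s a g) z"

text \<open>
  In \<open>kernel_f\<close> the power \<open>(z * exp (-x)) powr (1 - a)\<close> is read as
  \<open>z powr (1 - a) * exp ((a - 1) * x)\<close>, which is entire in \<open>x\<close>.
\<close>

definition kernel_f :: "complex \<Rightarrow> complex \<Rightarrow> complex \<Rightarrow> complex" where
  "kernel_f z x a =
     remove_sings (\<lambda>x. (1 - z powr (1 - a) * exp ((a - 1) * x)) / (1 - z * exp (- x))) x"

definition coeff_C :: "nat \<Rightarrow> complex \<Rightarrow> complex \<Rightarrow> complex" where
  "coeff_C n z a = (deriv ^^ n) (\<lambda>x. kernel_f z x a) 0 / fact n"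

definition remainder_R :: "nat \<Rightarrow> complex \<Rightarrow> complex \<Rightarrow> complex \<Rightarrow> complex" where
  "remainder_R N z s a =
     lerch_F z s a - (\<Sum>n<N. coeff_C n z a * (pochhammer s n / a powr (of_nat n + s)))"

end

theory Submission
  imports Defs "HOL-Real_Asymp.Real_Asymp"
begin

text \<open>
  Everything rests on the recursion in \<open>a\<close>. From
  \<open>\<Phi>(z,s,a) = a powr (- s) + z * \<Phi>(z,s,a+1)\<close> one gets, with \<open>b = a + m\<close>,
  \<open>F(z,s,b) = z ^ (- m) * F(z,s,a) - (\<Sum>j=1..m. z ^ (- j) * (b - j) powr (- s))\<close>
  (\<open>lerch_F_shift\<close>), and summing a finite geometric series in \<open>f\<close> gives the parallel identity
  \<open>C\<^sub>n(z,b) = z ^ (- m) * (\<Sum>k\<le>n. m ^ k / k! * C\<^sub>n\<^sub>-\<^sub>k(z,a)) - (\<Sum>j=1..m. z ^ (- j) * j ^ n / n!)\<close>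
  (\<open>coeff_C_add_nat\<close>). The numbers \<open>j ^ n / n! * (s)\<^sub>n / b powr (n + s)\<close> are exactly the terms of the binomial
  expansion of \<open>(b - j) powr (- s)\<close> in powers of \<open>j / b\<close>. So the remainder \<open>R\<^sub>N\<close> is
  \<open>z ^ (- m)\<close> times a quantity at the base point \<open>a\<close>, minus a sum of binomial remainders weighted
  by \<open>z ^ (- j)\<close> (\<open>remainder_R_shift\<close>).

  For the asymptotic estimate the base point is kept in the strip \<open>1 \<le> Re a \<le> 2\<close>, at fixed imaginary part.
  There \<open>F\<close> and the \<open>C\<^sub>n\<close> are bounded (\<open>lerch_F_bounded\<close>, \<open>continuous_on_coeff_C\<close>), which
  makes the first part \<open>O(z powr (- Re b))\<close>, and the binomial remainders are \<open>O(j ^ q * \<bar>b\<bar> powr (- N - Re s))\<close> for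
  some \<open>q\<close>, uniformly in \<open>j \<le> m\<close> (\<open>shifted_power_remainder\<close>); the weights \<open>z ^ (- j)\<close> absorb the power of \<open>j\<close>.
  If \<open>b \<ge> 2\<close> is an integer, the base point can be taken to be \<open>1\<close>, where \<open>F\<close> and \<open>f\<close> vanish. Only the finite
  sum over \<open>1 \<le> j \<le> b - 1\<close> is left, and the expansion becomes a finite combination of convergent binomial
  series in \<open>j / b\<close>.

  The one analytic ingredient is that the continuation of \<open>F\<close> exists on the slit plane, with a bound that is
  uniform for \<open>a\<close> in compact sets. Both come from the Mellin integral of \<open>exp (- a * x) * f(z,x,a)\<close>
  (\<open>is_lerch_F_continuation_mellin\<close>, \<open>lerch_kernel_bound\<close>), which is holomorphic in \<open>z\<close> by differentiation under
  the integral sign and reduces to the two power series when \<open>\<bar>z\<bar> < 1\<close>.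
\<close>

section \<open>Holomorphic Mellin transforms\<close>

text \<open>
  Difference quotients in \<open>z\<close> are dominated by the derivative bound that Cauchy's inequality extracts
  from the local majorant \<open>h\<close>, so dominated convergence differentiates under the integral sign; the majorant
  allows improper integrals.
\<close>

lemma holomorphic_on_parametric_integral:
  fixes f :: "complex \<Rightarrow> 'a::euclidean_space \<Rightarrow> complex"
  assumes "open U"
    and hol: "\<And>x. x \<in> S \<Longrightarrow> (\<lambda>z. f z x) holomorphic_on U"
    and int: "\<And>z. z \<in> U \<Longrightarrow> f z integrable_on S"
    and dom: "\<And>z. z \<in> U \<Longrightarrow> \<exists>r>0. cball z r \<subseteq> U \<and>
               (\<exists>h. h integrable_on S \<and> (\<forall>w\<in>cball z r. \<forall>x\<in>S. norm (f w x) \<le> h x))"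
  shows "(\<lambda>z. integral S (f z)) holomorphic_on U"
proof -
  have "(\<lambda>z. integral S (f z)) field_differentiable at z" if z: "z \<in> U" for z
  proof -
    obtain r h where r: "r > 0" "cball z r \<subseteq> U" and h: "h integrable_on S"
      and le: "\<And>w x. w \<in> cball z r \<Longrightarrow> x \<in> S \<Longrightarrow> norm (f w x) \<le> h x"
      using dom[OF z] by blast
    define f' where "f' x = deriv (\<lambda>z. f z x) z" for x
    have der: "((\<lambda>z. f z x) has_field_derivative deriv (\<lambda>z. f z x) w) (at w)"
      if "x \<in> S" "w \<in> U" for x w
      using holomorphic_derivI[OF hol[OF that(1)] \<open>open U\<close> that(2)] .
    have bd: "norm (deriv (\<lambda>z. f z x) w) \<le> h x / (r/2)" if x: "x \<in> S" and w: "w \<in> ball z (r/2)" for x w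
    proof -
      have sub: "cball w (r/2) \<subseteq> cball z r"
        using w by (simp add: cball_subset_cball_iff dist_commute)
      have hw: "(\<lambda>z. f z x) holomorphic_on cball w (r/2)"
        using hol[OF x] sub r holomorphic_on_subset by blast
      have "norm ((deriv ^^ 1) (\<lambda>z. f z x) w) \<le> fact 1 * h x / (r/2) ^ 1"
      proof (rule Cauchy_inequality)
        show "(\<lambda>z. f z x) holomorphic_on ball w (r/2)"
          using hw holomorphic_on_subset ball_subset_cball by blast
        show "continuous_on (cball w (r/2)) (\<lambda>z. f z x)"
          using hw holomorphic_on_imp_continuous_on by blast
        fix v assume "norm (w - v) = r/2"
        hence "v \<in> cball w (r/2)" by (simp add: dist_norm)
        thus "norm (f v x) \<le> h x" using le[OF _ x] sub by blast
      qed (use r in auto)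
      thus ?thesis by simp
    qed
    \<comment> \<open>On the smaller ball the derivative bound is uniform, hence so are the difference quotients.\<close>
    have lip: "norm (f v x - f z x) \<le> h x / (r/2) * norm (v - z)"
      if x: "x \<in> S" and v: "v \<in> ball z (r/2)" for x v
    proof (rule field_differentiable_bound[of "ball z (r/2)"])
      fix w assume w: "w \<in> ball z (r/2)"
      hence "w \<in> U" using r by auto
      thus "((\<lambda>z. f z x) has_field_derivative deriv (\<lambda>z. f z x) w) (at w within ball z (r/2))"
        using der[OF x] has_field_derivative_at_within by blast
      show "norm (deriv (\<lambda>z. f z x) w) \<le> h x / (r/2)" by (rule bd[OF x w])
    qed (use v r in auto)
    have "((\<lambda>w. (integral S (f w) - integral S (f z)) / (w - z)) \<longlongrightarrow> integral S f') (at z within ball z (r/2))"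
      unfolding tendsto_at_iff_sequentially
    proof safe
      fix X assume X: "\<forall>i. X i \<in> ball z (r/2) - {z}" and lim: "X \<longlonglongrightarrow> z"
      have XU: "X i \<in> U" "X i \<noteq> z" "X i \<in> ball z (r/2)" for i using X[rule_format, of i] r by auto
      define q where "q i x = (f (X i) x - f z x) / (X i - z)" for i x
      have qint: "q i integrable_on S" for i
        unfolding q_def using int[OF XU(1)] int[OF z]
        by (intro integrable_on_divide integrable_diff)
      have "(\<lambda>i. integral S (q i)) \<longlonglongrightarrow> integral S f'"
      proof (rule dominated_convergence(2)[where h = "\<lambda>x. h x / (r/2)"])
        show "(\<lambda>x. h x / (r/2)) integrable_on S" using h by (rule integrable_on_divide)
        fix i x assume x: "x \<in> S"
        show "norm (q i x) \<le> h x / (r/2)"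
          using lip[OF x XU(3)] XU(2)[of i] by (simp add: q_def norm_divide field_simps)
      next
        fix x assume x: "x \<in> S"
        have "((\<lambda>w. (f w x - f z x) / (w - z)) \<longlongrightarrow> f' x) (at z)"
          using der[OF x z] unfolding has_field_derivative_iff f'_def .
        thus "(\<lambda>i. q i x) \<longlonglongrightarrow> f' x"
          unfolding q_def using lim XU(2) by (auto simp: tendsto_at_iff_sequentially o_def)
      qed (fact qint)
      moreover have "integral S (q i) = (integral S (f (X i)) - integral S (f z)) / (X i - z)" for i
        unfolding q_def using int[OF XU(1)] int[OF z] by (simp add: integral_diff)
      ultimately show "((\<lambda>w. (integral S (f w) - integral S (f z)) / (w - z)) \<circ> X) \<longlonglongrightarrow> integral S f'"
        by (simp add: o_def)
    qed
    hence "((\<lambda>z. integral S (f z)) has_field_derivative integral S f') (at z within ball z (r/2))"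
      unfolding has_field_derivative_iff .
    thus ?thesis
      using r by (auto simp: field_differentiable_def at_within_open[of z "ball z (r/2)"])
  qed
  thus ?thesis using field_differentiable_at_within holomorphic_on_def by blast
qed

definition mellin :: "complex \<Rightarrow> (real \<Rightarrow> complex) \<Rightarrow> complex" where
  "mellin s f = integral {0<..} (\<lambda>x. of_real x powr (s - 1) * f x)"

text \<open>
  Up to a constant, a majorant of the Mellin integrand of any \<open>f\<close> that decays like \<open>exp (- d * x)\<close>;
  its integrability is that of the Gamma integral.
\<close>

definition mellin_weight :: "complex \<Rightarrow> real \<Rightarrow> real \<Rightarrow> real" where
  "mellin_weight s d x = norm (complex_of_real x powr (s - 1) / of_real (exp (d * x)))"

lemma mellin_weight_integrable:
  "Re s > 0 \<Longrightarrow> d > 0 \<Longrightarrow> mellin_weight s d integrable_on {0<..}"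
  using absolutely_integrable_norm[OF absolutely_integrable_Gamma_integral[of s d]]
  by (auto simp: o_def mellin_weight_def[abs_def] intro: absolutely_integrable_imp_integrable set_lebesgue_integral_eq_integral)

lemma mellin_integrand_bound:
  assumes "norm (f x) \<le> M * exp (- d * x)"
  shows "norm (of_real x powr (s - 1) * f x) \<le> M * mellin_weight s d x"
  using mult_left_mono[OF assms, of "norm (complex_of_real x powr (s - 1))"]
  by (simp add: norm_mult norm_divide mellin_weight_def exp_minus field_simps)

lemma mellin_integrable:
  assumes "Re s > 0" "d > 0" "continuous_on {0<..} f"
    and "\<And>x. x > 0 \<Longrightarrow> norm (f x) \<le> M * exp (- d * x)"
  shows "(\<lambda>x. of_real x powr (s - 1) * f x) integrable_on {0<..}"
proof -
  have "(\<lambda>x. of_real x powr (s - 1) * f x) absolutely_integrable_on {0<..}"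
  proof (rule measurable_bounded_by_integrable_imp_absolutely_integrable)
    have "continuous_on {0<..} (\<lambda>x. of_real x powr (s - 1) * f x)"
      by (intro continuous_intros assms) auto
    thus "(\<lambda>x. of_real x powr (s - 1) * f x) \<in> borel_measurable (lebesgue_on {0<..})"
      by (intro continuous_imp_measurable_on_sets_lebesgue) auto
    show "(\<lambda>x. M * mellin_weight s d x) integrable_on {0<..}"
      using mellin_weight_integrable[OF assms(1,2)] by (rule integrable_on_mult_right)
  qed (use assms(4) mellin_integrand_bound in auto)
  thus ?thesis by (rule set_lebesgue_integral_eq_integral(1))
qed

lemma norm_mellin_le:
  assumes "Re s > 0" "d > 0" "continuous_on {0<..} f"
    and "\<And>x. x > 0 \<Longrightarrow> norm (f x) \<le> M * exp (- d * x)"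
  shows "norm (mellin s f) \<le> M * integral {0<..} (mellin_weight s d)"
proof -
  have "norm (mellin s f) \<le> integral {0<..} (\<lambda>x. M * mellin_weight s d x)"
    unfolding mellin_def
    by (intro integral_norm_bound_integral mellin_integrable[OF assms]
          integrable_on_mult_right mellin_weight_integrable assms mellin_integrand_bound) auto
  thus ?thesis by simp
qed

lemma mellin_diff:
  assumes "Re s > 0" "d > 0" "continuous_on {0<..} f" "continuous_on {0<..} g"
    and "\<And>x. x > 0 \<Longrightarrow> norm (f x) \<le> M * exp (- d * x)"
    and "\<And>x. x > 0 \<Longrightarrow> norm (g x) \<le> M' * exp (- d * x)"
  shows "mellin s (\<lambda>x. f x - g x) = mellin s f - mellin s g"
  unfolding mellin_def right_diff_distrib
  by (rule integral_diff[OF mellin_integrable[OF assms(1,2,3,5)] mellin_integrable[OF assms(1,2,4,6)]])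

lemma mellin_cmult: "mellin s (\<lambda>x. c * f x) = c * mellin s f"
  unfolding mellin_def by (simp add: mult.left_commute)

lemma holomorphic_on_mellin:
  assumes "Re s > 0" "open U"
    and hol: "\<And>x. x > 0 \<Longrightarrow> (\<lambda>z. f z x) holomorphic_on U"
    and cont: "\<And>z. z \<in> U \<Longrightarrow> continuous_on {0<..} (f z)"
    and bound: "\<And>K. compact K \<Longrightarrow> K \<subseteq> U \<Longrightarrow>
                  \<exists>M d. d > 0 \<and> (\<forall>z\<in>K. \<forall>x>0. norm (f z x) \<le> M * exp (- d * x))"
  shows "(\<lambda>z. mellin s (f z)) holomorphic_on U"
  unfolding mellin_def
proof (rule holomorphic_on_parametric_integral)
  fix z assume z: "z \<in> U"
  obtain r where r: "r > 0" "cball z r \<subseteq> U"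
    using z \<open>open U\<close> open_contains_cball by blast
  obtain M d where Md: "d > 0" "\<And>w x. w \<in> cball z r \<Longrightarrow> x > 0 \<Longrightarrow> norm (f w x) \<le> M * exp (- d * x)"
    using bound[OF compact_cball r(2)] by blast
  have "z \<in> cball z r" using r by auto
  show "(\<lambda>x. of_real x powr (s - 1) * f z x) integrable_on {0<..}"
    using mellin_integrable[OF assms(1) Md(1) cont[OF z] Md(2)[OF \<open>z \<in> cball z r\<close>]] .
  show "\<exists>r>0. cball z r \<subseteq> U \<and> (\<exists>h. h integrable_on {0<..} \<and>
     (\<forall>w\<in>cball z r. \<forall>x\<in>{0<..}. norm (of_real x powr (s - 1) * f w x) \<le> h x))"
  proof (intro exI[of _ r] exI[of _ "\<lambda>x. M * mellin_weight s d x"] conjI ballI)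
    show "(\<lambda>x. M * mellin_weight s d x) integrable_on {0<..}"
      using mellin_weight_integrable[OF assms(1) Md(1)] by (rule integrable_on_mult_right)
  qed (use r Md(2) mellin_integrand_bound in auto)
qed (use assms in \<open>auto intro!: holomorphic_intros\<close>)

text \<open>
  The substitution \<open>t = a * x\<close> in Euler's integral.
\<close>

lemma mellin_exp_real:
  assumes s: "Re s > 0" and a: "(a::real) > 0"
  shows "mellin s (\<lambda>x. exp (- of_real a * of_real x)) = Gamma s / of_real a powr s"
proof -
  have img: "(*) a ` {0<..} = {0<..}"
    using a by (auto simp: image_iff intro!: bexI[of _ "x / a" for x])
  let ?G = "\<lambda>t. complex_of_real t powr (s - 1) / of_real (exp t)"
  have "integral {0<..} ?G = Gamma s"
    using Gamma_integral_complex'[OF s] by (rule integral_unique)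
  moreover have "((*) a has_field_derivative a) (at x within {0<..})" for x
    by (auto intro!: derivative_eq_intros)
  ultimately have "integral {0<..} (\<lambda>x. \<bar>a\<bar> *\<^sub>R ?G (a * x)) = Gamma s"
    using has_absolute_integral_change_of_variables_real[of "{0<..}" "(*) a" "\<lambda>_. a" ?G "Gamma s"]
      absolutely_integrable_Gamma_integral'[OF s] a
    unfolding img by (simp add: inj_on_def)
  also have "integral {0<..} (\<lambda>x. \<bar>a\<bar> *\<^sub>R ?G (a * x)) =
      integral {0<..} (\<lambda>x. of_real a powr s * (of_real x powr (s - 1) * exp (- of_real a * of_real x)))"
  proof (rule integral_cong)
    fix x :: real assume x: "x \<in> {0<..}"
    have "complex_of_real (a * x) powr (s - 1) = of_real a powr (s - 1) * of_real x powr (s - 1)"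
      using a x by (simp add: powr_times_real)
    moreover have "of_real a * of_real a powr (s - 1) = complex_of_real a powr s"
      using a by (simp add: powr_diff)
    ultimately show "\<bar>a\<bar> *\<^sub>R ?G (a * x) = of_real a powr s * (of_real x powr (s - 1) * exp (- of_real a * of_real x))"
      using a by (simp add: scaleR_conv_of_real exp_minus field_simps flip: exp_of_real)
  qed
  also have "\<dots> = of_real a powr s * mellin s (\<lambda>x. exp (- of_real a * of_real x))"
    by (simp add: mellin_def)
  finally show ?thesis using a by (simp add: field_simps)
qed

text \<open>
  The substitution is no longer available for complex \<open>a\<close>, but both sides are holomorphic on the
  right half plane and agree on the positive reals.
\<close>

lemma mellin_exp:
  assumes s: "Re s > 0" and a: "Re a > 0"
  shows "mellin s (\<lambda>x. exp (- a * of_real x)) = Gamma s / a powr s"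
proof -
  let ?U = "{a::complex. Re a > 0}"
  let ?g = "\<lambda>a. mellin s (\<lambda>x. exp (- a * of_real x)) - Gamma s / a powr s"
  have U: "open ?U" "convex ?U"
    by (simp_all add: open_halfspace_Re_gt convex_halfspace_Re_gt)
  have "(\<lambda>a. mellin s (\<lambda>x. exp (- a * of_real x))) holomorphic_on ?U"
  proof (rule holomorphic_on_mellin[OF s U(1)])
    fix K assume K: "compact K" "K \<subseteq> ?U"
    have "\<exists>d>0. \<forall>b\<in>K. d \<le> Re b"
    proof (cases "K = {}")
      case False
      moreover have "continuous_on K Re" by (intro continuous_intros)
      ultimately obtain c where "c \<in> K" "\<forall>b\<in>K. Re c \<le> Re b"
        using continuous_attains_inf[OF K(1)] by blast
      thus ?thesis using K by blast
    qed (auto intro: exI[of _ 1])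
    then obtain d where d: "d > 0" "\<And>b. b \<in> K \<Longrightarrow> d \<le> Re b" by blast
    show "\<exists>M d. d > 0 \<and> (\<forall>b\<in>K. \<forall>x>0. norm (exp (- b * of_real x)) \<le> M * exp (- d * x))"
      using d by (intro exI[of _ 1] exI[of _ d]) auto
  qed (auto intro!: holomorphic_intros continuous_intros)
  hence hol: "?g holomorphic_on ?U"
    by (intro holomorphic_intros) (auto simp: complex_nonpos_Reals_iff)
  have "?g a = 0"
  proof (rule analytic_continuation[OF hol U(1) convex_connected[OF U(2)], of "of_real ` {0<..}" 1])
    have "(1::real) islimpt {0<..}"
      by (simp add: interior_open interior_limit_point)
    hence "complex_of_real 1 islimpt of_real ` {0<..}"
      by (rule islimpt_isCont_image) (auto simp: eventually_at_filter)
    thus "1 islimpt complex_of_real ` {0<..}" by simp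
  qed (use a mellin_exp_real[OF s] in auto)
  thus ?thesis by simp
qed

section \<open>The integrand of the representation of F\<close>

text \<open>
  With \<open>E\<close> for this entire function, \<open>1 - exp w = - w * E w\<close>. Writing the numerator and the denominator
  of \<open>f(z,x,a)\<close> through \<open>E\<close> cancels the common zero at \<open>x = log z\<close>, so that the removable
  singularity on the path of integration never appears.
\<close>

definition expm1_quotient :: "complex \<Rightarrow> complex" where
  "expm1_quotient w = (if w = 0 then 1 else (exp w - 1) / w)"

lemma expm1_quotient_mult: "w * expm1_quotient w = exp w - 1"
  by (simp add: expm1_quotient_def)

lemma holomorphic_on_expm1_quotient: "expm1_quotient holomorphic_on A"
proof -
  have "(\<lambda>z. if z = 0 then deriv exp 0 else (exp z - exp 0) / (z - 0)) holomorphic_on (UNIV::complex set)"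
    by (rule pole_lemma) (auto intro: holomorphic_intros)
  moreover have "deriv exp (0::complex) = 1"
    by (rule DERIV_imp_deriv) (auto intro!: derivative_eq_intros)
  ultimately have "expm1_quotient holomorphic_on UNIV"
    by (simp add: expm1_quotient_def[abs_def] cong: if_cong)
  thus ?thesis using holomorphic_on_subset by blast
qed

lemmas holomorphic_on_expm1_quotient' [holomorphic_intros] =
  holomorphic_on_compose_gen[OF _ holomorphic_on_expm1_quotient subset_UNIV, unfolded o_def]

lemma continuous_on_expm1_quotient [continuous_intros]:
  "continuous_on A f \<Longrightarrow> continuous_on A (\<lambda>x. expm1_quotient (f x))"
  using continuous_on_compose2[OF holomorphic_on_imp_continuous_on[OF holomorphic_on_expm1_quotient]]
  by blast

lemma expm1_quotient_nonzero:
  assumes "\<bar>Im w\<bar> < 2 * pi"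
  shows "expm1_quotient w \<noteq> 0"
proof
  assume *: "expm1_quotient w = 0"
  hence "exp w = 1" and "w \<noteq> 0" using expm1_quotient_mult[of w] by (auto simp: expm1_quotient_def)
  then obtain n :: int where n: "Re w = 0" "Im w = of_int (2 * n) * pi" by (auto simp: exp_eq_1)
  hence "\<bar>real_of_int n\<bar> < 1" using assms by (simp add: abs_mult)
  hence "n = 0" by linarith
  thus False using n \<open>w \<noteq> 0\<close> by (simp add: complex_eq_iff)
qed

text \<open>
  The principal logarithm and real \<open>x\<close> stay inside the strip where \<open>E\<close> has no zeros.
\<close>

lemma expm1_quotient_Ln_nonzero:
  assumes "z \<noteq> 0"
  shows "expm1_quotient (Ln z - of_real x) \<noteq> 0"
  by (rule expm1_quotient_nonzero) (use mpi_less_Im_Ln[OF assms] Im_Ln_le_pi[OF assms] in auto)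

text \<open>
  This is \<open>exp (- a * x) * f(z,x,a)\<close> for real \<open>x\<close>, the integrand (without \<open>x powr (s - 1)\<close>) of the
  integral representation of \<open>F\<close>.
\<close>

definition lerch_kernel :: "complex \<Rightarrow> complex \<Rightarrow> real \<Rightarrow> complex" where
  "lerch_kernel a z x = exp (- a * of_real x) * ((1 - a) *
     expm1_quotient ((1 - a) * (Ln z - of_real x)) / expm1_quotient (Ln z - of_real x))"

lemma lerch_kernel_mult:
  assumes "z \<noteq> 0"
  shows "lerch_kernel a z x * (1 - z * exp (- of_real x)) =
           exp (- a * of_real x) - z powr (1 - a) * exp (- of_real x)"
proof -
  let ?u = "Ln z - of_real x"
  have u: "exp ?u = z * exp (- of_real x)" using assms by (simp add: exp_diff exp_minus field_simps)
  have "lerch_kernel a z x * (1 - exp ?u) =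
        - (exp (- a * of_real x) * (((1 - a) * ?u) * expm1_quotient ((1 - a) * ?u)))"
  proof -
    have "1 - exp ?u = - (?u * expm1_quotient ?u)" by (simp add: expm1_quotient_mult)
    thus ?thesis using expm1_quotient_Ln_nonzero[OF assms, of x] by (simp add: lerch_kernel_def)
  qed
  also have "\<dots> = exp (- a * of_real x) - exp (- a * of_real x + (1 - a) * ?u)"
    unfolding expm1_quotient_mult exp_add by (simp add: algebra_simps)
  also have "- a * of_real x + (1 - a) * ?u = (1 - a) * Ln z + - of_real x" by (simp add: algebra_simps)
  also have "exp \<dots> = z powr (1 - a) * exp (- of_real x)"
    using assms unfolding exp_add by (simp add: powr_def)
  finally show ?thesis using u by simp
qed

lemma continuous_on_lerch_kernel:
  "continuous_on (UNIV \<times> (- \<real>\<^sub>\<le>\<^sub>0) \<times> UNIV) (\<lambda>(a, z, x). lerch_kernel a z x)"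
  unfolding lerch_kernel_def case_prod_unfold
  by (intro continuous_intros) (auto intro!: expm1_quotient_Ln_nonzero)

lemma holomorphic_on_lerch_kernel: "(\<lambda>z. lerch_kernel a z x) holomorphic_on (- \<real>\<^sub>\<le>\<^sub>0)"
  unfolding lerch_kernel_def by (intro holomorphic_intros) (auto intro!: expm1_quotient_Ln_nonzero)

text \<open>
  Where \<open>\<bar>z * exp (- x)\<bar> \<le> 1/2\<close> the denominator of \<open>f\<close> is bounded below and the numerator contributes
  \<open>exp (- a * x)\<close> and \<open>z powr (1 - a) * exp (- x)\<close>; the remaining \<open>x\<close> form a compact interval.
  Uniformity in \<open>a\<close> is needed later for a segment of values of \<open>a\<close>, uniformity in \<open>z\<close> for
  holomorphy.
\<close>

lemma lerch_kernel_bound: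
  assumes "compact A" "A \<subseteq> {a. Re a \<ge> 1}" "compact K" "K \<subseteq> - \<real>\<^sub>\<le>\<^sub>0"
  shows "\<exists>M. \<forall>a\<in>A. \<forall>z\<in>K. \<forall>x\<ge>0. norm (lerch_kernel a z x) \<le> M * exp (- x)"
proof -
  have "continuous_on (A \<times> K) (\<lambda>p. exp ((1 - fst p) * Ln (snd p)))"
    using assms(4) by (intro continuous_intros) auto
  hence "bounded ((\<lambda>p. exp ((1 - fst p) * Ln (snd p))) ` (A \<times> K))"
    by (intro compact_imp_bounded compact_continuous_image compact_Times assms)
  then obtain B where "\<And>a z. a \<in> A \<Longrightarrow> z \<in> K \<Longrightarrow> norm (exp ((1 - a) * Ln z)) \<le> B"
    by (force simp: bounded_iff)
  hence B: "norm (z powr (1 - a)) \<le> B" if "a \<in> A" "z \<in> K" for a z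
  proof -
    have "z \<noteq> 0" using that assms(4) by auto
    thus ?thesis using \<open>\<And>a z. a \<in> A \<Longrightarrow> z \<in> K \<Longrightarrow> norm (exp ((1 - a) * Ln z)) \<le> B\<close>[OF that]
      by (simp only: powr_def if_False)
  qed
  obtain R where R: "R > 0" "\<And>z. z \<in> K \<Longrightarrow> norm z \<le> R"
    using compact_imp_bounded[OF assms(3)] by (auto simp: bounded_pos)
  \<comment> \<open>Beyond this point \<open>norm (z * exp (- x)) \<le> 1/2\<close> for all \<open>z \<in> K\<close>.\<close>
  define X where "X = ln (2 * R)"
  have "bounded ((\<lambda>(a, z, x). lerch_kernel a z x) ` (A \<times> K \<times> {0..X}))"
    using assms by (intro compact_imp_bounded compact_continuous_image compact_Times
        continuous_on_subset[OF continuous_on_lerch_kernel]) auto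
  then obtain C where C: "\<And>a z x. a \<in> A \<Longrightarrow> z \<in> K \<Longrightarrow> x \<in> {0..X} \<Longrightarrow> norm (lerch_kernel a z x) \<le> C"
    by (force simp: bounded_iff)
  show ?thesis
  proof (intro exI ballI allI impI)
    fix a z and x :: real assume a: "a \<in> A" and z: "z \<in> K" and x: "x \<ge> 0"
    show "norm (lerch_kernel a z x) \<le> max (2 * (1 + B)) (C * exp X) * exp (- x)"
    proof (cases "x \<le> X")
      case True
      have "0 \<le> C" using C[OF a z, of x] True x norm_ge_zero by (meson atLeastAtMost_iff order_trans)
      have "norm (lerch_kernel a z x) \<le> C * 1" using C[OF a z] x True by simp
      also have "\<dots> \<le> C * exp (X - x)" using True \<open>0 \<le> C\<close> by (intro mult_left_mono) auto
      also have "\<dots> = (C * exp X) * exp (- x)" by (simp add: exp_diff exp_minus field_simps)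
      also have "\<dots> \<le> max (2 * (1 + B)) (C * exp X) * exp (- x)" by (intro mult_right_mono) auto
      finally show ?thesis .
    next
      case False
      have "z \<noteq> 0" using z assms by auto
      have "exp X \<le> exp x" using False by simp
      hence "2 * R \<le> exp x" using R(1) by (simp add: X_def)
      hence "norm z \<le> exp x / 2" using R(2)[OF z] by simp
      moreover have "norm (z * exp (- of_real x)) = norm z / exp x"
        by (simp add: norm_mult exp_minus_inverse divide_inverse flip: exp_minus)
      ultimately have "norm (z * exp (- of_real x)) \<le> 1/2"
        by (simp only:) (simp add: field_simps)
      hence half: "1/2 \<le> norm (1 - z * exp (- of_real x))"
        using norm_triangle_ineq2[of 1 "z * exp (- of_real x)"] by simp
      have "norm (lerch_kernel a z x) * (1/2) \<le> norm (lerch_kernel a z x) * norm (1 - z * exp (- of_real x))"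
        using half by (intro mult_left_mono) auto
      also have "\<dots> = norm (exp (- a * of_real x) - z powr (1 - a) * exp (- of_real x))"
        by (simp add: lerch_kernel_mult[OF \<open>z \<noteq> 0\<close>] flip: norm_mult)
      also have "\<dots> \<le> norm (exp (- a * of_real x)) + norm (z powr (1 - a) * exp (- of_real x))"
        by (rule norm_triangle_ineq4)
      also have "\<dots> \<le> exp (- x) + B * exp (- x)"
        using a assms(2) x B[OF a z] mult_right_mono[of 1 "Re a" x]
        by (intro add_mono) (auto simp: norm_mult intro!: mult_right_mono)
      finally have "norm (lerch_kernel a z x) \<le> 2 * (1 + B) * exp (- x)" by (simp add: algebra_simps)
      also have "\<dots> \<le> max (2 * (1 + B)) (C * exp X) * exp (- x)" by (intro mult_right_mono) auto
      finally show ?thesis .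
    qed
  qed
qed

section \<open>Analytic continuation and recursion of F\<close>

text \<open>
  The argument is at most \<open>pi\<close> in absolute value, so a complex exponent costs only a constant factor.
\<close>

lemma norm_inverse_powr_le:
  assumes "w \<noteq> (0::complex)"
  shows "norm (1 / w powr s) \<le> exp (pi * \<bar>Im s\<bar>) * norm w powr (- Re s)"
proof -
  have "\<bar>Im s * Arg w\<bar> \<le> \<bar>Im s\<bar> * pi"
    unfolding abs_mult using Arg_le_pi[of w] mpi_less_Arg[of w] by (intro mult_left_mono) auto
  hence "exp (Im s * Arg w) \<le> exp (pi * \<bar>Im s\<bar>)" by (simp add: mult.commute)
  hence "norm w powr (- Re s) * exp (Im s * Arg w) \<le> norm w powr (- Re s) * exp (pi * \<bar>Im s\<bar>)"
    by (intro mult_left_mono) auto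
  moreover have "norm (1 / w powr s) = norm w powr (- Re s) * exp (Im s * Arg w)"
    by (simp add: norm_divide norm_powr_complex powr_minus exp_minus field_simps)
  ultimately show ?thesis by (simp add: mult.commute)
qed

lemma norm_inverse_powr_le_const:
  assumes "norm (w::complex) \<ge> 1" "Re s \<ge> 0"
  shows "norm (1 / w powr s) \<le> exp (pi * \<bar>Im s\<bar>)"
proof -
  have "norm w \<noteq> 0" using assms by auto
  hence "norm w powr (- Re s) \<le> 1" using powr_mono[of "- Re s" 0 "norm w"] assms by simp
  hence "exp (pi * \<bar>Im s\<bar>) * norm w powr (- Re s) \<le> exp (pi * \<bar>Im s\<bar>) * 1"
    using assms by (intro mult_left_mono) auto
  moreover have "w \<noteq> 0" using assms by auto
  ultimately show ?thesis using norm_inverse_powr_le[of w s] by linarith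
qed

lemma norm_add_nat_ge_1:
  assumes "Re a \<ge> 1"
  shows "norm (a + of_nat n) \<ge> 1"
  using complex_Re_le_cmod[of "a + of_nat n"] assms by simp

lemma summable_lerch_series:
  assumes "Re s > 0" "Re a \<ge> 1" "norm z < 1"
  shows "summable (\<lambda>n. z ^ n / (a + of_nat n) powr s)"
proof (rule summable_comparison_test')
  show "summable (\<lambda>n. exp (pi * \<bar>Im s\<bar>) * norm z ^ n)"
    using assms by (intro summable_mult summable_geometric) auto
  fix n :: nat
  have "norm (z ^ n / (a + of_nat n) powr s) = norm z ^ n * norm (1 / (a + of_nat n) powr s)"
    by (simp add: norm_divide norm_power)
  also have "\<dots> \<le> norm z ^ n * exp (pi * \<bar>Im s\<bar>)"
    using assms norm_add_nat_ge_1[of a n] by (intro mult_left_mono norm_inverse_powr_le_const) auto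
  finally show "norm (z ^ n / (a + of_nat n) powr s) \<le> exp (pi * \<bar>Im s\<bar>) * norm z ^ n"
    by (simp add: mult.commute)
qed

lemma lerch_series_Suc:
  assumes "Re s > 0" "Re a \<ge> 1" "norm z < 1"
  shows "lerch_series z s a = 1 / a powr s + z * lerch_series z s (a + 1)"
proof -
  have "lerch_series z s a = 1 / a powr s + (\<Sum>n. z * (z ^ n / (a + 1 + of_nat n) powr s))"
    using suminf_split_head[OF summable_lerch_series[OF assms]]
    by (simp add: lerch_series_def add_ac algebra_simps)
  also have "(\<Sum>n. z * (z ^ n / (a + 1 + of_nat n) powr s)) = z * lerch_series z s (a + 1)"
    unfolding lerch_series_def using assms by (intro suminf_mult summable_lerch_series) auto
  finally show ?thesis .
qed

lemma polylog_series_eq_lerch_series: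
  assumes "Re s > 0" "norm z < 1"
  shows "polylog_series s z = z * lerch_series z s 1"
proof -
  have "polylog_series s z = (\<Sum>n. z * (z ^ n / (1 + of_nat n) powr s))"
    by (simp add: polylog_series_def add_ac)
  also have "\<dots> = z * lerch_series z s 1"
    unfolding lerch_series_def using assms by (intro suminf_mult summable_lerch_series) auto
  finally show ?thesis .
qed

lemma open_connected_slit_plane: "open (- \<real>\<^sub>\<le>\<^sub>0 :: complex set)" "connected (- \<real>\<^sub>\<le>\<^sub>0 :: complex set)"
proof -
  have "- complex_of_real ` {..0} = - \<real>\<^sub>\<le>\<^sub>0"
    by (auto simp: complex_slot_left_eq complex_nonpos_Reals_iff)
  thus "connected (- \<real>\<^sub>\<le>\<^sub>0 :: complex set)"
    using starlike_imp_connected[OF starlike_slotted_complex_plane_left[of 0]] by simp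
qed (simp add: open_Compl)

lemma lerch_F_eq:
  assumes g: "is_lerch_F_continuation s a g" and z: "z \<notin> \<real>\<^sub>\<le>\<^sub>0"
  shows "lerch_F z s a = g z"
proof -
  define h where "h = (SOME g. is_lerch_F_continuation s a g)"
  have h: "is_lerch_F_continuation s a h" unfolding h_def using g by (rule someI[of "is_lerch_F_continuation s a"])
  have "h z = g z"
  proof (rule analytic_continuation_open[of "ball 0 1 \<inter> - \<real>\<^sub>\<le>\<^sub>0" "- \<real>\<^sub>\<le>\<^sub>0" h g])
    have "1/2 \<in> ball 0 1 \<inter> - (\<real>\<^sub>\<le>\<^sub>0 :: complex set)" by (auto simp: complex_nonpos_Reals_iff)
    thus "ball 0 1 \<inter> - (\<real>\<^sub>\<le>\<^sub>0 :: complex set) \<noteq> {}" by blast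
  qed (use g h z open_connected_slit_plane in \<open>auto simp: is_lerch_F_continuation_def\<close>)
  thus ?thesis by (simp add: lerch_F_def h_def)
qed

text \<open>
  At \<open>a = 1\<close> the two series cancel exactly, since \<open>Li(z) = z * \<Phi>(z,s,1)\<close>. Hence \<open>F\<close> is a finite sum for
  every positive integer \<open>a\<close>.
\<close>

lemma is_lerch_F_continuation_1:
  assumes "Re s > 0"
  shows "is_lerch_F_continuation s 1 (\<lambda>_. 0)"
  using assms by (auto simp: is_lerch_F_continuation_def polylog_series_eq_lerch_series)

text \<open>
  \<open>\<Phi>(z,s,a) = a powr (- s) + z * \<Phi>(z,s,a+1)\<close> while \<open>Li(z) / z powr a\<close> merely picks up a factor \<open>z\<close>,
  so continuing \<open>F\<close> for one \<open>a\<close> continues it for all \<open>a + m\<close>.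
\<close>

lemma is_lerch_F_continuation_add_nat:
  assumes s: "Re s > 0" and a: "Re a \<ge> 1" and g: "is_lerch_F_continuation s a g"
  shows "is_lerch_F_continuation s (a + of_nat m)
           (\<lambda>z. (g z - (\<Sum>k<m. z ^ k / (a + of_nat k) powr s)) / z ^ m)"
proof -
  have "lerch_series z s (a + of_nat m) - polylog_series s z / z powr (a + of_nat m) =
        (lerch_series z s a - polylog_series s z / z powr a
          - (\<Sum>k<m. z ^ k / (a + of_nat k) powr s)) / z ^ m"
    if z: "z \<noteq> 0" "norm z < 1" for z
  proof (induction m)
    case (Suc m)
    have "lerch_series z s (a + of_nat m) =
            1 / (a + of_nat m) powr s + z * lerch_series z s (a + of_nat (Suc m))"
      using lerch_series_Suc[OF s _ z(2), of "a + of_nat m"] a by (simp add: add_ac)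
    moreover have "z powr (a + of_nat (Suc m)) = z powr (a + of_nat m) * z"
      using z(1) powr_add[of z "a + of_nat m" 1] by (simp add: add_ac)
    ultimately have "lerch_series z s (a + of_nat (Suc m)) - polylog_series s z / z powr (a + of_nat (Suc m)) =
        (lerch_series z s (a + of_nat m) - polylog_series s z / z powr (a + of_nat m)
          - 1 / (a + of_nat m) powr s) / z"
      using z(1) by (simp add: diff_divide_distrib add_divide_distrib)
    thus ?case unfolding Suc using z(1) by (simp add: field_simps)
  qed simp
  moreover have "z \<noteq> 0" if "z \<notin> \<real>\<^sub>\<le>\<^sub>0" for z :: complex using that by auto
  ultimately show ?thesis using g
    by (auto simp: is_lerch_F_continuation_def simp del: of_nat_add intro!: holomorphic_intros)
qed

lemma continuous_on_lerch_kernel_x: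
  "z \<notin> \<real>\<^sub>\<le>\<^sub>0 \<Longrightarrow> continuous_on A (lerch_kernel a z)"
  unfolding lerch_kernel_def
  by (intro continuous_intros) (auto intro!: expm1_quotient_Ln_nonzero)

text \<open>
  Multiplying the kernel by \<open>1 - z * exp (- x)\<close> leaves two exponentials. Hence each step
  \<open>N \<rightarrow> N + 1\<close> splits off one term of the two series, and the \<open>N\<close>-th remainder is an explicit
  integral carrying the factor \<open>(z * exp (- x)) ^ N\<close>.
\<close>

lemma mellin_lerch_kernel_partial:
  assumes s: "Re s > 0" and a: "Re a \<ge> 1" and z: "z \<notin> \<real>\<^sub>\<le>\<^sub>0" "norm z < 1"
    and M: "\<And>x. x > 0 \<Longrightarrow> norm (lerch_kernel a z x) \<le> M * exp (- 1 * x)"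
  shows "mellin s (\<lambda>x. (z * exp (- of_real x)) ^ N * lerch_kernel a z x) =
           mellin s (lerch_kernel a z) - Gamma s * (\<Sum>n<N. z ^ n / (a + of_nat n) powr s
               - z powr (1 - a) * (z ^ n / (1 + of_nat n) powr s))"
proof (induction N)
  case (Suc N)
  let ?w = "\<lambda>x. z * exp (- complex_of_real x)"
  let ?e = "\<lambda>b x. exp (- b * complex_of_real x)"
  have z0: "z \<noteq> 0" using z by auto
  have ew: "exp (- complex_of_real x) ^ N * ?e b x = ?e (b + of_nat N) x" for b x
    by (simp add: exp_add exp_diff exp_of_nat_mult exp_minus field_simps)
  have split: "?w x ^ Suc N * lerch_kernel a z x = ?w x ^ N * lerch_kernel a z x -
          (z ^ N * ?e (a + of_nat N) x - z ^ N * z powr (1 - a) * ?e (1 + of_nat N) x)" for x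
  proof -
    have "?w x ^ N * lerch_kernel a z x - ?w x ^ Suc N * lerch_kernel a z x
            = ?w x ^ N * (lerch_kernel a z x * (1 - ?w x))" by (simp add: algebra_simps)
    also have "\<dots> = z ^ N * (exp (- complex_of_real x) ^ N * ?e a x)
                 - z ^ N * z powr (1 - a) * (exp (- complex_of_real x) ^ N * ?e 1 x)"
      unfolding lerch_kernel_mult[OF z0] by (simp add: power_mult_distrib algebra_simps)
    finally show ?thesis unfolding ew by (simp add: algebra_simps)
  qed
  have le1: "norm (?w x) \<le> 1" if "x > 0" for x
    using z(2) that mult_mono[of "norm z" 1 "exp (- x)" 1] by (simp add: norm_mult)
  have b1: "norm (?w x ^ N * lerch_kernel a z x) \<le> M * exp (- 1 * x)" if "x > 0" for x
  proof -
    have "norm (?w x ^ N * lerch_kernel a z x) \<le> 1 * norm (lerch_kernel a z x)"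
      unfolding norm_mult[of "_ ^ _"] norm_power using le1[OF that] by (intro mult_right_mono power_le_one) auto
    thus ?thesis using M[OF that] by simp
  qed
  have b2: "norm (c * ?e b x) \<le> norm c * exp (- 1 * x)" if "x > 0" "Re b \<ge> 1" for x b c
    using that mult_right_mono[of 1 "Re b" x] by (simp add: norm_mult mult_left_mono)
  have b3: "norm (c * ?e b x - c' * ?e b' x) \<le> (norm c + norm c') * exp (- 1 * x)"
    if "x > 0" "Re b \<ge> 1" "Re b' \<ge> 1" for x b c b' c'
    using norm_triangle_ineq4[of "c * ?e b x" "c' * ?e b' x"] b2[of x b c] b2[of x b' c'] that
    by (simp add: algebra_simps)
  have Re: "Re (a + of_nat N) \<ge> 1" "Re (1 + of_nat N) \<ge> 1" using a by auto
  have "mellin s (\<lambda>x. ?w x ^ Suc N * lerch_kernel a z x) =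
          mellin s (\<lambda>x. ?w x ^ N * lerch_kernel a z x) -
          mellin s (\<lambda>x. z ^ N * ?e (a + of_nat N) x - z ^ N * z powr (1 - a) * ?e (1 + of_nat N) x)"
    unfolding split
    by (rule mellin_diff[OF s zero_less_one _ _ b1 b3])
       (use Re in \<open>auto intro!: continuous_intros continuous_on_lerch_kernel_x z\<close>)
  also have "mellin s (\<lambda>x. z ^ N * ?e (a + of_nat N) x - z ^ N * z powr (1 - a) * ?e (1 + of_nat N) x)
      = mellin s (\<lambda>x. z ^ N * ?e (a + of_nat N) x) - mellin s (\<lambda>x. z ^ N * z powr (1 - a) * ?e (1 + of_nat N) x)"
    by (rule mellin_diff[OF s zero_less_one _ _ b2 b2])
       (use Re in \<open>auto intro!: continuous_intros\<close>)
  also have "\<dots> = Gamma s * (z ^ N / (a + of_nat N) powr s - z powr (1 - a) * (z ^ N / (1 + of_nat N) powr s))"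
    using Re by (simp only: mellin_cmult mellin_exp[OF s]) (simp add: mellin_exp[OF s] algebra_simps)
  finally show ?case unfolding Suc by (simp add: algebra_simps)
qed simp

text \<open>
  The integral representation of \<open>F\<close>: it is holomorphic on the whole slit plane, and in the unit disc
  the remainder integrals are \<open>O(\<bar>z\<bar> ^ N)\<close>.
\<close>

lemma is_lerch_F_continuation_mellin:
  assumes s: "Re s > 0" and a: "Re a \<ge> 1"
  shows "is_lerch_F_continuation s a (\<lambda>z. rGamma s * mellin s (lerch_kernel a z))"
  unfolding is_lerch_F_continuation_def
proof (intro conjI allI impI)
  have "(\<lambda>z. mellin s (lerch_kernel a z)) holomorphic_on (- \<real>\<^sub>\<le>\<^sub>0)"
  proof (rule holomorphic_on_mellin[OF s open_connected_slit_plane(1) holomorphic_on_lerch_kernel])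
    fix K :: "complex set" assume K: "compact K" "K \<subseteq> - \<real>\<^sub>\<le>\<^sub>0"
    obtain M where "\<And>z x. z \<in> K \<Longrightarrow> x \<ge> 0 \<Longrightarrow> norm (lerch_kernel a z x) \<le> M * exp (- x)"
      using lerch_kernel_bound[of "{a}", OF _ _ K] a by auto
    thus "\<exists>M d. d > 0 \<and> (\<forall>z\<in>K. \<forall>x>0. norm (lerch_kernel a z x) \<le> M * exp (- d * x))"
      by (intro exI[of _ M] exI[of _ 1]) auto
  qed (auto intro: continuous_on_lerch_kernel_x)
  thus "(\<lambda>z. rGamma s * mellin s (lerch_kernel a z)) holomorphic_on (- \<real>\<^sub>\<le>\<^sub>0)"
    by (intro holomorphic_intros)
next
  fix z :: complex assume z: "norm z < 1 \<and> z \<notin> \<real>\<^sub>\<le>\<^sub>0"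
  hence z0: "z \<noteq> 0" by auto
  obtain M where M: "\<And>x. x \<ge> 0 \<Longrightarrow> norm (lerch_kernel a z x) \<le> M * exp (- x)"
    using lerch_kernel_bound[of "{a}" "{z}"] a z by auto
  define P where "P N = (\<Sum>n<N. z ^ n / (a + of_nat n) powr s - z powr (1 - a) * (z ^ n / (1 + of_nat n) powr s))" for N
  define I where "I = integral {0<..} (mellin_weight s 1)"
  have "P \<longlonglongrightarrow> lerch_series z s a - z powr (1 - a) * lerch_series z s 1"
    unfolding P_def lerch_series_def sums_def[symmetric] using z a s
    by (intro sums_diff sums_mult summable_sums summable_lerch_series) auto
  moreover have "P \<longlonglongrightarrow> rGamma s * mellin s (lerch_kernel a z)"
  proof -
    let ?r = "\<lambda>N. mellin s (\<lambda>x. (z * exp (- of_real x)) ^ N * lerch_kernel a z x)"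
    have eq: "P N = rGamma s * (mellin s (lerch_kernel a z) - ?r N)" for N
    proof -
      have "s \<notin> \<int>\<^sub>\<le>\<^sub>0" using s by (auto elim!: nonpos_Ints_cases)
      hence "rGamma s * Gamma s = 1" by (simp add: rGamma_inverse_Gamma Gamma_eq_zero_iff)
      moreover have "?r N = mellin s (lerch_kernel a z) - Gamma s * P N"
        unfolding P_def using mellin_lerch_kernel_partial[OF s a, of z M N] z M by simp
      ultimately show ?thesis by (simp flip: mult.assoc)
    qed
    have "?r \<longlonglongrightarrow> 0"
    proof (rule Lim_null_comparison)
      have "norm (?r N) \<le> (norm z ^ N * M) * I" for N
        unfolding I_def
      proof (rule norm_mellin_le[OF s zero_less_one])
        fix x :: real assume x: "x > 0"
        have "norm (z * exp (- of_real x)) \<le> norm z" using x by (simp add: norm_mult mult_left_le)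
        hence "norm ((z * exp (- of_real x)) ^ N * lerch_kernel a z x) \<le> norm z ^ N * (M * exp (- x))"
          unfolding norm_mult[of "_ ^ _"] norm_power using M[of x] x by (intro mult_mono power_mono) auto
        thus "norm ((z * exp (- of_real x)) ^ N * lerch_kernel a z x) \<le> norm z ^ N * M * exp (- 1 * x)"
          by simp
      qed (use z in \<open>auto intro!: continuous_intros continuous_on_lerch_kernel_x\<close>)
      thus "\<forall>\<^sub>F N in sequentially. norm (?r N) \<le> (norm z ^ N * M) * I" by simp
      have "(\<lambda>N. (norm z ^ N * M) * I) \<longlonglongrightarrow> (0 * M) * I"
        using z by (intro tendsto_intros LIMSEQ_power_zero) auto
      thus "(\<lambda>N. (norm z ^ N * M) * I) \<longlonglongrightarrow> 0" by simp
    qed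
    hence "(\<lambda>N. rGamma s * (mellin s (lerch_kernel a z) - ?r N)) \<longlonglongrightarrow> rGamma s * (mellin s (lerch_kernel a z) - 0)"
      by (intro tendsto_intros)
    moreover have "P = (\<lambda>N. rGamma s * (mellin s (lerch_kernel a z) - ?r N))" using eq by (rule ext)
    ultimately show ?thesis by simp
  qed
  ultimately have "rGamma s * mellin s (lerch_kernel a z) = lerch_series z s a - z powr (1 - a) * lerch_series z s 1"
    by (rule LIMSEQ_unique[rotated])
  thus "rGamma s * mellin s (lerch_kernel a z) = lerch_series z s a - polylog_series s z / z powr a"
    using z z0 s by (simp add: polylog_series_eq_lerch_series powr_diff)
qed

text \<open>
  The recursion in \<open>a\<close>, with the summation index counted downwards from \<open>a + m\<close>: in this form the sum is
  a geometrically weighted sum of \<open>(b - j) powr (- s)\<close> with \<open>b = a + m\<close>.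
\<close>

lemma lerch_F_shift:
  assumes "Re s > 0" "Re a \<ge> 1" "z \<notin> \<real>\<^sub>\<le>\<^sub>0"
  shows "lerch_F z s (a + of_nat m) =
           lerch_F z s a / z ^ m - (\<Sum>j=1..m. 1 / z ^ j * (1 / (a + of_nat m - of_nat j) powr s))"
proof -
  have z: "z \<noteq> 0" using assms(3) by auto
  have "(\<Sum>k<m. z ^ k / (a + of_nat k) powr s) / z ^ m =
          (\<Sum>j=1..m. 1 / z ^ j * (1 / (a + of_nat m - of_nat j) powr s))"
    unfolding sum_divide_distrib
    by (rule sum.reindex_bij_witness[of _ "\<lambda>j. m - j" "\<lambda>k. m - k"])
       (use z in \<open>auto simp: of_nat_diff power_diff field_simps\<close>)
  moreover note g = is_lerch_F_continuation_mellin[OF assms(1,2)]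
  ultimately show ?thesis
    using lerch_F_eq[OF is_lerch_F_continuation_add_nat[OF assms(1,2) g] assms(3), of m]
      lerch_F_eq[OF g assms(3)]
    by (simp add: diff_divide_distrib)
qed

lemma lerch_F_bounded:
  assumes s: "Re s > 0" and A: "compact A" "A \<subseteq> {a. Re a \<ge> 1}" and z: "z \<notin> \<real>\<^sub>\<le>\<^sub>0"
  obtains B where "\<And>a. a \<in> A \<Longrightarrow> norm (lerch_F z s a) \<le> B"
proof -
  obtain M where M: "\<And>a x. a \<in> A \<Longrightarrow> x \<ge> 0 \<Longrightarrow> norm (lerch_kernel a z x) \<le> M * exp (- x)"
    using lerch_kernel_bound[OF A, of "{z}"] z by auto
  show thesis
  proof (rule that)
    fix a assume a: "a \<in> A"
    have "norm (mellin s (lerch_kernel a z)) \<le> M * integral {0<..} (mellin_weight s 1)"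
      using M[OF a] by (intro norm_mellin_le s continuous_on_lerch_kernel_x z) auto
    moreover have "lerch_F z s a = rGamma s * mellin s (lerch_kernel a z)"
      using lerch_F_eq[OF is_lerch_F_continuation_mellin[OF s] z] a A by blast
    ultimately show "norm (lerch_F z s a) \<le> norm (rGamma s) * (M * integral {0<..} (mellin_weight s 1))"
      by (simp add: norm_mult mult_left_mono)
  qed
qed

section \<open>Remainders of the binomial expansion\<close>

text \<open>
  Both arguments lie in \<open>(-pi/2, pi/2)\<close>, so their difference is again a principal argument.
\<close>

lemma powr_divide_Re_pos:
  assumes "Re a > 0" "Re b > 0"
  shows "(b / a) powr s = b powr s / a powr (s :: complex)"
proof -
  have nz: "a \<noteq> 0" "b \<noteq> 0" using assms by auto
  have "Ln (b / a) = Ln b - Ln a"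
    using Re_Ln_pos_lt_imp[OF assms(1)] Re_Ln_pos_lt_imp[OF assms(2)] nz
    by (intro Ln_unique) (auto simp: exp_diff)
  thus ?thesis using nz by (simp add: powr_def exp_diff right_diff_distrib)
qed

lemma neg_binomial_sums:
  assumes "norm (w::complex) < 1"
  shows "(\<lambda>n. pochhammer s n / fact n * w ^ n) sums (1 / (1 - w) powr s)"
proof -
  have "(\<lambda>n. (- s gchoose n) * (- w) ^ n) sums (1 + - w) powr (- s)"
    by (rule gen_binomial_complex) (use assms in simp)
  moreover have "(- s gchoose n) * (- w) ^ n = pochhammer s n / fact n * w ^ n" for n
    unfolding gbinomial_pochhammer power_minus[of w n] by (simp add: mult.left_commute)
  ultimately show ?thesis by (simp add: powr_minus divide_inverse)
qed

text \<open>
  The remainder is \<open>w ^ N\<close> times a power series that converges absolutely at \<open>1/2\<close>.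
\<close>

lemma neg_binomial_remainder:
  fixes s :: complex
  obtains C where "C \<ge> 0" "\<And>w. norm w \<le> 1/2 \<Longrightarrow>
    norm (1 / (1 - w) powr s - (\<Sum>n<N. pochhammer s n / fact n * w ^ n)) \<le> C * norm w ^ N"
proof -
  define b where "b n = pochhammer s n / fact n" for n
  \<comment> \<open>Convergence at \<open>3/4\<close> forces absolute convergence at the smaller radius \<open>1/2\<close>.\<close>
  have "summable (\<lambda>n. b n * (3/4) ^ n)"
    using neg_binomial_sums[of "3/4" s] unfolding b_def by (auto simp: sums_iff)
  hence "summable (\<lambda>n. norm (b n * (1/2) ^ n))" by (rule powser_insidea) simp
  hence "summable (\<lambda>n. norm (b (n + N) * (1/2) ^ (n + N)))" by (rule summable_ignore_initial_segment)
  hence "summable (\<lambda>n. 2 ^ N * norm (b (n + N) * (1/2) ^ (n + N)))" by (rule summable_mult)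
  moreover have "2 ^ N * norm (b (n + N) * (1/2) ^ (n + N)) = norm (b (n + N)) * (1/2) ^ n" for n
    by (simp add: norm_mult norm_power norm_divide power_add field_simps)
  ultimately have sm: "summable (\<lambda>n. norm (b (n + N)) * (1/2) ^ n)" by simp
  show thesis
  proof (rule that)
    show "0 \<le> (\<Sum>n. norm (b (n + N)) * (1/2) ^ n)" using sm by (rule suminf_nonneg) auto
    fix w :: complex assume w: "norm w \<le> 1/2"
    have "(\<lambda>n. b (n + N) * w ^ (n + N)) sums (1 / (1 - w) powr s - (\<Sum>n<N. b n * w ^ n))"
      using neg_binomial_sums[of w s] w unfolding b_def by (intro sums_split_initial_segment) auto
    moreover have le: "norm (b (n + N) * w ^ (n + N)) \<le> norm w ^ N * (norm (b (n + N)) * (1/2) ^ n)" for n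
    proof -
      have "norm (b (n + N) * w ^ (n + N)) = norm w ^ N * (norm (b (n + N)) * norm w ^ n)"
        by (simp add: norm_mult norm_power power_add)
      also have "\<dots> \<le> norm w ^ N * (norm (b (n + N)) * (1/2) ^ n)"
        using w by (intro mult_left_mono power_mono) auto
      finally show ?thesis .
    qed
    ultimately have "norm (1 / (1 - w) powr s - (\<Sum>n<N. b n * w ^ n))
        \<le> (\<Sum>n. norm w ^ N * (norm (b (n + N)) * (1/2) ^ n))"
      using norm_suminf_le[OF le summable_mult[OF sm]] by (simp add: sums_iff)
    also have "\<dots> = (\<Sum>n. norm (b (n + N)) * (1/2) ^ n) * norm w ^ N"
      using suminf_mult[OF sm] by simp
    finally show "norm (1 / (1 - w) powr s - (\<Sum>n<N. pochhammer s n / fact n * w ^ n))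
        \<le> (\<Sum>n. norm (b (n + N)) * (1/2) ^ n) * norm w ^ N" unfolding b_def .
  qed
qed

text \<open>
  Expand \<open>(a - j) powr (- s) = a powr (- s) * (1 - j / a) powr (- s)\<close>. For \<open>j \<le> \<bar>a\<bar> / 2\<close> this is the
  binomial remainder, which costs only \<open>j ^ N\<close>. For larger \<open>j\<close> nothing cancels and every term is estimated by
  itself; since then \<open>1 < 2 * j / \<bar>a\<bar>\<close>, powers of this ratio may be inserted for free, which gives the same
  decay in \<open>\<bar>a\<bar>\<close> at the price of a larger power of \<open>j\<close>. That power is harmless, because the estimate is
  summed against \<open>z ^ (- j)\<close> with \<open>z > 1\<close>.
\<close>

lemma shifted_power_remainder:
  fixes s :: complex
  assumes s: "Re s > 0"
  obtains C q where "\<And>a j. j \<ge> 1 \<Longrightarrow> Re a \<ge> real j + 1 \<Longrightarrow>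
    norm (1 / (a - of_nat j) powr s
            - (\<Sum>n<N. of_nat j ^ n / fact n * (pochhammer s n / a powr (of_nat n + s))))
      \<le> C * real j ^ q * norm a powr (- real N - Re s)"
proof -
  define b where "b n = pochhammer s n / fact n" for n
  define \<kappa> where "\<kappa> = exp (pi * \<bar>Im s\<bar>)"
  obtain C1 where C1: "C1 \<ge> 0" "\<And>w. norm w \<le> 1/2 \<Longrightarrow>
    norm (1 / (1 - w) powr s - (\<Sum>n<N. b n * w ^ n)) \<le> C1 * norm w ^ N"
    unfolding b_def using neg_binomial_remainder[of s N] by auto
  define B where "B = (\<Sum>n<N. norm (b n))"
  define p where "p = nat \<lceil>Re s\<rceil>"
  define C where "C = \<kappa> * C1 + \<kappa> * (2 ^ (N + p) + B * 2 ^ N)"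
  have \<kappa>: "\<kappa> > 0" and B: "B \<ge> 0" by (auto simp: \<kappa>_def B_def intro: sum_nonneg)
  have p: "Re s \<le> real p" unfolding p_def by linarith
  show thesis
  proof (rule that)
    fix a :: complex and j :: nat assume j: "j \<ge> 1" and a: "Re a \<ge> real j + 1"
    define w where "w = of_nat j / a"
    have a0: "a \<noteq> 0" and Rea: "Re a > 0" "Re (a - of_nat j) > 0" using a j by auto
    have na: "norm a \<ge> real j + 1" using a complex_Re_le_cmod[of a] by linarith
    have eq1: "1 / (a - of_nat j) powr s = 1 / a powr s * (1 / (1 - w) powr s)"
      using powr_divide_Re_pos[OF Rea, of s] a0 by (simp add: w_def diff_divide_distrib)
    have "of_nat j ^ n / fact n * (pochhammer s n / a powr (of_nat n + s)) = 1 / a powr s * (b n * w ^ n)" for n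
      using a0 by (simp add: b_def w_def powr_add power_divide field_simps)
    hence eq2: "(\<Sum>n<N. of_nat j ^ n / fact n * (pochhammer s n / a powr (of_nat n + s))) =
                  1 / a powr s * (\<Sum>n<N. b n * w ^ n)" by (simp add: sum_distrib_left)
    have nw: "norm w = real j / norm a" by (simp add: w_def norm_divide)
    have \<kappa>a: "norm (1 / a powr s) \<le> \<kappa> * norm a powr (- Re s)"
      unfolding \<kappa>_def by (rule norm_inverse_powr_le[OF a0])
    have wN: "norm a powr (- Re s) * norm w ^ N = real j ^ N * norm a powr (- real N - Re s)"
      using a0 by (simp add: nw power_divide powr_diff powr_minus powr_realpow field_simps)
    have jN: "real j ^ N \<le> real j ^ (N + p)" using j by (intro power_increasing) auto
    have "norm (1 / (a - of_nat j) powr s - 1 / a powr s * (\<Sum>n<N. b n * w ^ n))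
            \<le> C * real j ^ (N + p) * norm a powr (- real N - Re s)"
    proof (cases "norm w \<le> 1/2")
      case True
      have "norm (1 / (a - of_nat j) powr s - 1 / a powr s * (\<Sum>n<N. b n * w ^ n)) =
              norm (1 / a powr s) * norm (1 / (1 - w) powr s - (\<Sum>n<N. b n * w ^ n))"
        unfolding eq1 by (simp flip: norm_mult add: right_diff_distrib)
      also have "\<dots> \<le> (\<kappa> * norm a powr (- Re s)) * (C1 * norm w ^ N)"
        using \<kappa> by (intro mult_mono \<kappa>a C1(2) True) auto
      also have "\<dots> = \<kappa> * C1 * (norm a powr (- Re s) * norm w ^ N)" by simp
      also have "\<dots> = \<kappa> * C1 * real j ^ N * norm a powr (- real N - Re s)" unfolding wN by simp
      also have "\<dots> \<le> C * real j ^ (N + p) * norm a powr (- real N - Re s)"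
        using \<kappa> B C1(1) by (intro mult_right_mono mult_mono jN) (auto simp: C_def)
      finally show ?thesis .
    next
      case False
      hence jw: "1 \<le> 2 * real j / norm a" using a0 by (simp add: nw field_simps)
      have w1: "norm w \<le> 1" using na a0 by (simp add: nw field_simps)
      have "norm (\<Sum>n<N. b n * w ^ n) \<le> B"
        unfolding B_def using w1 by (intro sum_norm_le) (simp add: norm_mult norm_power mult_left_le power_le_one)
      hence "norm (1 / a powr s * (\<Sum>n<N. b n * w ^ n)) \<le> (\<kappa> * norm a powr (- Re s)) * B"
        unfolding norm_mult using \<kappa> by (intro mult_mono \<kappa>a) auto
      also have "\<dots> \<le> (\<kappa> * norm a powr (- Re s)) * B * (2 * norm w) ^ N"
        using False \<kappa> B mult_left_mono[OF one_le_power[of "2 * norm w" N], of "(\<kappa> * norm a powr (- Re s)) * B"]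
        by simp
      also have "\<dots> = \<kappa> * (B * 2 ^ N) * (norm a powr (- Re s) * norm w ^ N)" by (simp add: power_mult_distrib)
      also have "\<dots> = \<kappa> * (B * 2 ^ N) * real j ^ N * norm a powr (- real N - Re s)" unfolding wN by simp
      also have "\<dots> \<le> \<kappa> * (B * 2 ^ N) * real j ^ (N + p) * norm a powr (- real N - Re s)"
        using \<kappa> B by (intro mult_right_mono mult_left_mono jN) auto
      finally have b1: "norm (1 / a powr s * (\<Sum>n<N. b n * w ^ n)) \<le>
            \<kappa> * (B * 2 ^ N) * real j ^ (N + p) * norm a powr (- real N - Re s)" .
      have "norm (1 / (a - of_nat j) powr s) \<le> \<kappa>"
        unfolding \<kappa>_def using a s complex_Re_le_cmod[of "a - of_nat j"] by (intro norm_inverse_powr_le_const) auto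
      also have "\<dots> \<le> \<kappa> * (2 * real j / norm a) powr (real N + Re s)"
        using jw \<kappa> s by (simp add: ge_one_powr_ge_zero)
      also have "\<dots> = \<kappa> * (2 * real j) powr (real N + Re s) * norm a powr (- real N - Re s)"
        using j a0 by (simp add: powr_divide powr_diff powr_minus powr_add field_simps)
      also have "\<dots> \<le> \<kappa> * (2 * real j) powr (real (N + p)) * norm a powr (- real N - Re s)"
        using j p \<kappa> by (intro mult_right_mono mult_left_mono powr_mono) auto
      also have "(2 * real j) powr (real (N + p)) = 2 ^ (N + p) * real j ^ (N + p)"
        using j by (subst powr_realpow) (auto simp: power_mult_distrib)
      finally have b2: "norm (1 / (a - of_nat j) powr s) \<le>
            \<kappa> * (2 ^ (N + p) * real j ^ (N + p)) * norm a powr (- real N - Re s)" .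
      have "norm (1 / (a - of_nat j) powr s - 1 / a powr s * (\<Sum>n<N. b n * w ^ n)) \<le>
              (\<kappa> * (2 ^ (N + p) + B * 2 ^ N)) * (real j ^ (N + p) * norm a powr (- real N - Re s))"
        using norm_triangle_ineq4[of "1 / (a - of_nat j) powr s" "1 / a powr s * (\<Sum>n<N. b n * w ^ n)"] b1 b2
        by (simp add: algebra_simps)
      also have "\<dots> \<le> C * (real j ^ (N + p) * norm a powr (- real N - Re s))"
        using \<kappa> C1(1) by (intro mult_right_mono) (auto simp: C_def)
      finally show ?thesis by (simp add: mult.assoc)
    qed
    thus "norm (1 / (a - of_nat j) powr s
            - (\<Sum>n<N. of_nat j ^ n / fact n * (pochhammer s n / a powr (of_nat n + s))))
          \<le> C * real j ^ (N + p) * norm a powr (- real N - Re s)" unfolding eq2 .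
  qed
qed

section \<open>The Taylor coefficients of the kernel\<close>

definition lerch_quotient :: "complex \<Rightarrow> complex \<Rightarrow> complex \<Rightarrow> complex" where
  "lerch_quotient z a x = (1 - z powr (1 - a) * exp ((a - 1) * x)) / (1 - z * exp (- x))"

lemma kernel_f_eq: "kernel_f z x a = remove_sings (lerch_quotient z a) x"
  by (simp add: kernel_f_def lerch_quotient_def[abs_def])

lemma lerch_quotient_1: "z \<noteq> 0 \<Longrightarrow> lerch_quotient z 1 x = 0"
  by (simp add: lerch_quotient_def)

lemma lerch_quotient_add_1:
  assumes "z \<noteq> 0" "z * exp (- x) \<noteq> 1"
  shows "lerch_quotient z (a + 1) x = exp x / z * (lerch_quotient z a x - 1)"
proof -
  define c where "c = z powr (1 - a) * exp ((a - 1) * x)"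
  have "z powr (1 - a) = z powr (- a) * z" using assms powr_add[of z "- a" 1] by simp
  moreover have "exp (a * x) = exp ((a - 1) * x) * exp x" by (simp flip: exp_add add: algebra_simps)
  ultimately have "z powr (1 - (a + 1)) * exp ((a + 1 - 1) * x) = c * (exp x / z)"
    using assms(1) by (simp add: c_def)
  thus ?thesis using assms
    unfolding lerch_quotient_def c_def[symmetric] by (simp add: exp_minus field_simps)
qed

text \<open>
  With \<open>w = z * exp (- x)\<close> this is the finite geometric sum
  \<open>(1 - w ^ (- m)) / (1 - w) = - (w ^ (-1) + \<dots> + w ^ (- m))\<close>; it is the counterpart for \<open>f\<close>
  of the recursion for \<open>F\<close>.
\<close>

lemma lerch_quotient_add_nat:
  assumes "z \<noteq> 0" "z * exp (- x) \<noteq> 1"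
  shows "lerch_quotient z (a + of_nat m) x =
           (exp x / z) ^ m * lerch_quotient z a x - (\<Sum>j=1..m. (exp x / z) ^ j)"
proof (induction m arbitrary: a)
  case (Suc m)
  have "lerch_quotient z (a + of_nat (Suc m)) x = lerch_quotient z ((a + 1) + of_nat m) x"
    by (simp add: add_ac)
  thus ?case unfolding Suc lerch_quotient_add_1[OF assms] by (simp add: algebra_simps)
qed simp

lemma has_fps_expansion_exp_power:
  "(\<lambda>x. (exp x / z) ^ m) has_fps_expansion fps_const (1 / z ^ m) * fps_exp (of_nat m :: complex)"
proof -
  have "(\<lambda>x. 1 / z ^ m * exp (of_nat m * x)) has_fps_expansion fps_const (1 / z ^ m) * fps_exp (of_nat m :: complex)"
    by (intro fps_expansion_intros)
  thus ?thesis by (simp add: power_divide exp_of_nat_mult)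
qed

lemma coeff_C_eq_fps_nth:
  assumes "(\<lambda>x. kernel_f z x a) has_fps_expansion F"
  shows "coeff_C n z a = fps_nth F n"
  using fps_nth_fps_expansion[OF assms, of n] by (simp add: coeff_C_def)

lemma eventually_denominator_nonzero:
  assumes "z \<noteq> (1::complex)"
  shows "\<forall>\<^sub>F x in nhds 0. z * exp (- x) \<noteq> 1"
proof -
  have "open {x::complex. z * exp (- x) \<noteq> 1}" by (intro open_Collect_neq continuous_intros)
  thus ?thesis using assms eventually_nhds_in_open[of "{x. z * exp (- x) \<noteq> 1}" 0] by simp
qed

lemma kernel_f_has_fps_expansion:
  assumes z: "z \<noteq> 1" and F: "lerch_quotient z a has_fps_expansion F"
  shows "(\<lambda>x. kernel_f z x a) has_fps_expansion F"
proof -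
  from eventually_denominator_nonzero[OF z] have ev: "\<forall>\<^sub>F x in nhds 0. lerch_quotient z a x = kernel_f z x a"
  proof eventually_elim
    case (elim x)
    have "lerch_quotient z a analytic_on {x}"
      unfolding lerch_quotient_def[abs_def] using elim by (intro analytic_intros) auto
    thus ?case by (simp add: kernel_f_eq)
  qed
  show ?thesis by (rule has_fps_expansion_cong[THEN iffD1, OF ev refl F])
qed

text \<open>
  One series \<open>G\<close>, that of \<open>1 / (1 - z * exp (- x))\<close>, serves all \<open>a\<close>; this makes the dependence of the
  coefficients on \<open>a\<close> explicit.
\<close>

lemma lerch_quotient_fps_expansion:
  assumes "z \<noteq> 1"
  shows "\<exists>G. \<forall>a. lerch_quotient z a has_fps_expansion
                     (1 - fps_const (z powr (1 - a)) * fps_exp (a - 1)) * G"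
proof -
  have "(\<lambda>x. 1 / (1 - z * exp (- x))) analytic_on {0}"
    using assms by (intro analytic_intros) auto
  then obtain G where G: "(\<lambda>x. 1 / (1 - z * exp (- x))) has_fps_expansion G"
    using analytic_at_imp_has_fps_expansion_0 by blast
  show ?thesis
  proof (intro exI allI)
    fix a
    have "(\<lambda>x. (1 - z powr (1 - a) * exp ((a - 1) * x)) * (1 / (1 - z * exp (- x)))) has_fps_expansion
            (1 - fps_const (z powr (1 - a)) * fps_exp (a - 1)) * G"
      by (intro fps_expansion_intros G)
    thus "lerch_quotient z a has_fps_expansion (1 - fps_const (z powr (1 - a)) * fps_exp (a - 1)) * G"
      by (simp add: lerch_quotient_def[abs_def])
  qed
qed

lemma continuous_on_coeff_C:
  assumes "z \<noteq> 0" "z \<noteq> 1"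
  shows "continuous_on A (\<lambda>a. coeff_C n z a)"
proof -
  obtain G where G: "\<And>a. lerch_quotient z a has_fps_expansion
                     (1 - fps_const (z powr (1 - a)) * fps_exp (a - 1)) * G"
    using lerch_quotient_fps_expansion[OF assms(2)] by blast
  have "coeff_C n z a = (\<Sum>i=0..n. ((if i = 0 then 1 else 0) - z powr (1 - a) * ((a - 1) ^ i / fact i)) * fps_nth G (n - i))" for a
    unfolding coeff_C_eq_fps_nth[OF kernel_f_has_fps_expansion[OF assms(2) G]]
    by (simp add: fps_mult_nth[of _ G])
  moreover have "z powr (1 - a) = exp ((1 - a) * Ln z)" for a using assms by (simp add: powr_def)
  ultimately show ?thesis by (auto intro!: continuous_intros)
qed

lemma coeff_C_add_nat:
  assumes "z \<noteq> 0" "z \<noteq> 1"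
  shows "coeff_C n z (a + of_nat m) =
           (\<Sum>k=0..n. of_nat m ^ k / fact k * coeff_C (n - k) z a) / z ^ m
             - (\<Sum>j=1..m. of_nat j ^ n / (z ^ j * fact n))"
proof -
  obtain F where F: "lerch_quotient z a has_fps_expansion F"
    using lerch_quotient_fps_expansion[OF assms(2)] by blast
  have exp: "(\<lambda>x. (exp x / z) ^ m * lerch_quotient z a x - (\<Sum>j=1..m. (exp x / z) ^ j)) has_fps_expansion
         fps_const (1 / z ^ m) * fps_exp (of_nat m) * F - (\<Sum>j=1..m. fps_const (1 / z ^ j) * fps_exp (of_nat j))"
    by (intro fps_expansion_intros has_fps_expansion_exp_power F)
  from eventually_denominator_nonzero[OF assms(2)] have ev: "\<forall>\<^sub>F x in nhds 0. (exp x / z) ^ m * lerch_quotient z a x - (\<Sum>j=1..m. (exp x / z) ^ j)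
            = lerch_quotient z (a + of_nat m) x"
    by eventually_elim (use lerch_quotient_add_nat[OF assms(1)] in simp)
  have "lerch_quotient z (a + of_nat m) has_fps_expansion
         fps_const (1 / z ^ m) * fps_exp (of_nat m) * F - (\<Sum>j=1..m. fps_const (1 / z ^ j) * fps_exp (of_nat j))"
    by (rule has_fps_expansion_cong[THEN iffD1, OF ev refl exp])
  hence "coeff_C n z (a + of_nat m) =
     fps_nth (fps_const (1 / z ^ m) * (fps_exp (of_nat m) * F) - (\<Sum>j=1..m. fps_const (1 / z ^ j) * fps_exp (of_nat j))) n"
    unfolding mult.assoc by (intro coeff_C_eq_fps_nth kernel_f_has_fps_expansion assms)
  also have "\<dots> = (\<Sum>k=0..n. of_nat m ^ k / fact k * fps_nth F (n - k)) / z ^ m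
             - (\<Sum>j=1..m. of_nat j ^ n / (z ^ j * fact n))"
    by (simp add: fps_sum_nth fps_mult_nth[of "fps_exp _"])
  finally show ?thesis
    by (simp add: coeff_C_eq_fps_nth[OF kernel_f_has_fps_expansion[OF assms(2) F]])
qed

text \<open>
  For integer \<open>a\<close> the function \<open>f\<close> is an exponential polynomial in \<open>x\<close>, with removable singularities
  only. In particular \<open>z = 1\<close>, where the singularity sits at the expansion point \<open>x = 0\<close>, is covered.
\<close>

lemma coeff_C_of_nat:
  assumes "z \<noteq> 0"
  shows "coeff_C n z (of_nat (Suc m)) = - (\<Sum>j=1..m. of_nat j ^ n / (z ^ j * fact n))"
proof -
  have "kernel_f z x (of_nat (Suc m)) = - (\<Sum>j=1..m. (exp x / z) ^ j)" for x
    unfolding kernel_f_eq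
  proof (rule remove_sings_eqI, rule Lim_transform_eventually)
    show "((\<lambda>x. - (\<Sum>j=1..m. (exp x / z) ^ j)) \<longlongrightarrow> - (\<Sum>j=1..m. (exp x / z) ^ j)) (at x)"
      using assms by (intro tendsto_intros) auto
    \<comment> \<open>The zeros of the denominator differ by multiples of \<open>2 * pi * \<i>\<close>, hence are isolated.\<close>
    have "\<forall>\<^sub>F y in at x. z * exp (- y) \<noteq> 1"
    proof (cases "z * exp (- x) = 1")
      case True
      have "z * exp (- y) \<noteq> 1" if "y \<noteq> x" "dist y x < 1" for y
      proof -
        have "\<bar>Im (x - y)\<bar> < 2 * pi"
          using that abs_Im_le_cmod[of "x - y"] pi_gt3 by (simp add: dist_norm norm_minus_commute)
        hence "exp (x - y) \<noteq> 1"
          using expm1_quotient_nonzero[of "x - y"] expm1_quotient_mult[of "x - y"] that by auto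
        moreover have "z * exp (- y) = (z * exp (- x)) * exp (x - y)"
          by (simp add: mult.assoc flip: exp_add)
        ultimately show ?thesis using True by simp
      qed
      thus ?thesis unfolding eventually_at by (intro exI[of _ 1]) auto
    next
      case False
      thus ?thesis by (intro tendsto_imp_eventually_ne[where c = "z * exp (- x)"] tendsto_intros)
    qed
    thus "\<forall>\<^sub>F y in at x. - (\<Sum>j=1..m. (exp y / z) ^ j) = lerch_quotient z (of_nat (Suc m)) y"
    proof eventually_elim
      case (elim y)
      thus ?case using lerch_quotient_add_nat[OF assms, of y 1 m] by (simp add: lerch_quotient_1 assms)
    qed
  qed
  hence "(\<lambda>x. kernel_f z x (of_nat (Suc m))) has_fps_expansion - (\<Sum>j=1..m. fps_const (1 / z ^ j) * fps_exp (of_nat j))"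
    by (simp, intro fps_expansion_intros has_fps_expansion_exp_power)
  from coeff_C_eq_fps_nth[OF this] show ?thesis by (simp add: fps_sum_nth)
qed

section \<open>The asymptotic expansion\<close>

text \<open>
  The recursions for \<open>F\<close> and for the \<open>C\<^sub>n\<close> split the remainder into \<open>z ^ (- m)\<close> times data at the
  base point \<open>a\<close>, and a geometrically weighted sum of binomial remainders.
\<close>

lemma remainder_R_shift:
  fixes s a z :: complex and m :: nat
  assumes "Re s > 0" "Re a \<ge> 1" "z \<notin> \<real>\<^sub>\<le>\<^sub>0" "z \<noteq> 1"
  defines "P \<equiv> \<lambda>n. pochhammer s n / (a + of_nat m) powr (of_nat n + s)"
  shows "remainder_R N z s (a + of_nat m) =
           (lerch_F z s a - (\<Sum>n<N. (\<Sum>k=0..n. of_nat m ^ k / fact k * coeff_C (n - k) z a) * P n)) / z ^ m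
           - (\<Sum>j=1..m. 1 / z ^ j *
                (1 / (a + of_nat m - of_nat j) powr s - (\<Sum>n<N. of_nat j ^ n / fact n * P n)))"
proof -
  have z: "z \<noteq> 0" using assms(3) by auto
  let ?X = "\<lambda>n. \<Sum>k=0..n. of_nat m ^ k / fact k * coeff_C (n - k) z a"
  have "(\<Sum>n<N. (\<Sum>j=1..m. of_nat j ^ n / (z ^ j * fact n)) * P n) =
          (\<Sum>j=1..m. 1 / z ^ j * (\<Sum>n<N. of_nat j ^ n / fact n * P n))"
    unfolding sum_distrib_left sum_distrib_right by (subst sum.swap) simp
  hence "(\<Sum>n<N. coeff_C n z (a + of_nat m) * P n) = (\<Sum>n<N. ?X n * P n) / z ^ m
           - (\<Sum>j=1..m. 1 / z ^ j * (\<Sum>n<N. of_nat j ^ n / fact n * P n))"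
    by (simp add: coeff_C_add_nat[OF z assms(4)] left_diff_distrib sum_subtractf flip: sum_divide_distrib)
  thus ?thesis
    unfolding remainder_R_def lerch_F_shift[OF assms(1-3)] P_def
    by (simp add: diff_divide_distrib right_diff_distrib sum_subtractf)
qed

lemma summable_power_times_geometric:
  fixes z :: real
  assumes "z > 1"
  shows "summable (\<lambda>j. real j ^ q / z ^ j)"
proof -
  have "(\<lambda>j. real j ^ q / z ^ j) \<in> O(\<lambda>j. real j powr (-2))"
    using assms by real_asymp
  moreover have "summable (\<lambda>j. norm (real j powr (-2)))"
    using summable_real_powr_iff[of "-2"] by simp
  ultimately show ?thesis by (rule summable_comparison_test_bigo[rotated])
qed

text \<open>
  Write \<open>Complex x t = a + m\<close> with \<open>1 \<le> Re a \<le> 2\<close>. The base point then runs through a compact segment, on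
  which \<open>F\<close> and the \<open>C\<^sub>n\<close> are bounded, so the first part of the remainder is \<open>O(z ^ (- m))\<close>; the second
  part is \<open>O(x powr (- N - Re s))\<close>.
\<close>

lemma remainder_R_bound:
  fixes s :: complex and z t :: real and N :: nat
  assumes s: "Re s > 0" and z: "z > 1"
  shows "\<exists>K. \<forall>\<^sub>F x in at_top. norm (remainder_R N (of_real z) s (Complex x t))
             \<le> K * (x powr (1 - real N - Re s) + norm (Complex x t) * z powr (- x))"
proof -
  let ?z = "complex_of_real z"
  have z': "?z \<notin> \<real>\<^sub>\<le>\<^sub>0" "?z \<noteq> 0" "?z \<noteq> 1" using z by (auto simp: complex_nonpos_Reals_iff)
  define A where "A = (\<lambda>r. Complex r t) ` {1..2}"
  have A: "compact A"
    unfolding A_def Complex_eq by (intro compact_continuous_image continuous_intros) auto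
  have "A \<subseteq> {a. Re a \<ge> 1}" by (auto simp: A_def)
  then obtain B where B: "\<And>a. a \<in> A \<Longrightarrow> norm (lerch_F ?z s a) \<le> B"
    using lerch_F_bounded[OF s A _ z'(1)] by blast
  have "bounded ((\<lambda>a. \<Sum>n<N. norm (coeff_C n ?z a)) ` A)"
    by (intro compact_imp_bounded compact_continuous_image A continuous_on_sum continuous_on_norm
              continuous_on_coeff_C z')
  then obtain D where D': "\<forall>y\<in>(\<lambda>a. \<Sum>n<N. norm (coeff_C n ?z a)) ` A. norm y \<le> D"
    unfolding bounded_iff by blast
  have D: "(\<Sum>n<N. norm (coeff_C n ?z a)) \<le> D" if "a \<in> A" for a
    using D'[rule_format, OF imageI[OF that]] unfolding real_norm_def by (rule abs_le_D1)
  have coeff: "norm (coeff_C n ?z a) \<le> D" if "a \<in> A" "n < N" for a n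
    using D[OF that(1)] member_le_sum[of n "{..<N}" "\<lambda>n. norm (coeff_C n ?z a)"] that by simp
  obtain C q where C: "\<And>a j. j \<ge> 1 \<Longrightarrow> Re a \<ge> real j + 1 \<Longrightarrow>
    norm (1 / (a - of_nat j) powr s
            - (\<Sum>n<N. of_nat j ^ n / fact n * (pochhammer s n / a powr (of_nat n + s))))
      \<le> C * real j ^ q * norm a powr (- real N - Re s)"
    using shifted_power_remainder[OF s, of N] by blast
  define \<kappa> where "\<kappa> = exp (pi * \<bar>Im s\<bar>)"
  define E where "E = B + (\<Sum>n<N. (real n + 1) * (D * (norm (pochhammer s n) * \<kappa>)))"
  define S where "S = (\<Sum>j. real j ^ q / z ^ j)"
  have "norm (remainder_R N ?z s (Complex x t))
          \<le> (\<bar>C\<bar> * S + \<bar>E\<bar> * z ^ 2) * (x powr (1 - real N - Re s) + norm (Complex x t) * z powr (- x))"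
    if x: "x \<ge> 3" for x
  proof -
    \<comment> \<open>One less than the floor of \<open>x\<close>, so that the base point has real part at least \<open>1\<close>.\<close>
    define m where "m = nat (\<lfloor>x\<rfloor> - 1)"
    define a where "a = Complex (x - real m) t"
    have m: "1 \<le> x - real m" "x - real m \<le> 2" unfolding m_def using x by linarith+
    have aA: "a \<in> A" and Rea: "Re a \<ge> 1" using m by (auto simp: a_def A_def)
    have ax: "Complex x t = a + of_nat m" by (simp add: a_def complex_eq_iff)
    define b where "b = a + of_nat m"
    have Reb: "Re b = x" using ax by (metis b_def complex.sel(1))
    have nb: "norm b \<ge> x" using complex_Re_le_cmod[of b] Reb by simp
    hence b1: "norm b \<ge> 1" "b \<noteq> 0" "norm b \<ge> real m" using x m by auto
    define P where "P n = pochhammer s n / b powr (of_nat n + s)" for n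
    \<comment> \<open>Since \<open>m \<le> norm b\<close>, the factor \<open>m ^ k\<close> is absorbed by \<open>b powr n\<close>.\<close>
    have P: "real m ^ k * norm (P n) \<le> norm (pochhammer s n) * \<kappa>" if "k \<le> n" for k n
    proof -
      have "real m ^ k \<le> norm b ^ n"
        using b1 that power_mono[of "real m" "norm b" k] power_increasing[of k n "norm b"] by linarith
      moreover have "norm (P n) \<le> norm (pochhammer s n) * (\<kappa> * norm b powr (- (real n + Re s)))"
        using mult_left_mono[OF norm_inverse_powr_le[OF b1(2), of "of_nat n + s"], of "norm (pochhammer s n)"]
        by (simp add: P_def \<kappa>_def norm_divide)
      ultimately have "real m ^ k * norm (P n) \<le>
          norm b ^ n * (norm (pochhammer s n) * (\<kappa> * norm b powr (- (real n + Re s))))"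
        by (intro mult_mono) auto
      also have "\<dots> = norm (pochhammer s n) * \<kappa> * (norm b powr real n * norm b powr (- (real n + Re s)))"
        using b1 by (simp add: powr_realpow)
      also have "norm b powr real n * norm b powr (- (real n + Re s)) = norm b powr (- Re s)"
        by (simp flip: powr_add)
      also have "\<dots> \<le> 1" using b1 s powr_mono[of "- Re s" 0 "norm b"] by simp
      finally show ?thesis by (simp add: \<kappa>_def mult_left_mono)
    qed
    have "norm (lerch_F ?z s a - (\<Sum>n<N. (\<Sum>k=0..n. of_nat m ^ k / fact k * coeff_C (n - k) ?z a) * P n)) \<le> E"
    proof -
      have "norm ((\<Sum>k=0..n. of_nat m ^ k / fact k * coeff_C (n - k) ?z a) * P n)
               \<le> (real n + 1) * (D * (norm (pochhammer s n) * \<kappa>))" if n: "n < N" for n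
      proof -
        have "norm (of_nat m ^ k / fact k * coeff_C (n - k) ?z a * P n) \<le> D * (norm (pochhammer s n) * \<kappa>)"
          if k: "k \<le> n" for k
        proof -
          have "norm (of_nat m ^ k / fact k * coeff_C (n - k) ?z a * P n)
                  = norm (coeff_C (n - k) ?z a) * ((real m ^ k * norm (P n)) / fact k)"
            by (simp add: norm_mult norm_divide norm_power)
          also have "\<dots> \<le> D * (norm (pochhammer s n) * \<kappa>)"
          proof (rule mult_mono)
            show c: "norm (coeff_C (n - k) ?z a) \<le> D" using coeff[OF aA, of "n - k"] n by simp
            show "0 \<le> D" using norm_ge_zero c by (rule order_trans)
            have "real m ^ k * norm (P n) / fact k \<le> real m ^ k * norm (P n) / 1"
              by (intro divide_left_mono) auto
            thus "real m ^ k * norm (P n) / fact k \<le> norm (pochhammer s n) * \<kappa>"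
              using P[OF k] by simp
          qed simp
          finally show ?thesis .
        qed
        hence "norm (\<Sum>k=0..n. of_nat m ^ k / fact k * coeff_C (n - k) ?z a * P n)
                 \<le> (\<Sum>k=0..n. D * (norm (pochhammer s n) * \<kappa>))" by (intro sum_norm_le) auto
        thus ?thesis unfolding sum_distrib_right by (simp add: add.commute)
      qed
      hence "norm (\<Sum>n<N. (\<Sum>k=0..n. of_nat m ^ k / fact k * coeff_C (n - k) ?z a) * P n)
               \<le> (\<Sum>n<N. (real n + 1) * (D * (norm (pochhammer s n) * \<kappa>)))"
        by (intro sum_norm_le) auto
      thus ?thesis unfolding E_def using B[OF aA]
        by (intro order_trans[OF norm_triangle_ineq4] add_mono)
    qed
    hence "norm ((lerch_F ?z s a - (\<Sum>n<N. (\<Sum>k=0..n. of_nat m ^ k / fact k * coeff_C (n - k) ?z a) * P n)) / ?z ^ m)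
             \<le> \<bar>E\<bar> / z ^ m"
      using z by (auto simp: norm_divide norm_power intro!: divide_right_mono)
    also have "\<dots> \<le> \<bar>E\<bar> * z ^ 2 * (norm b * z powr (- x))"
    proof -
      have "1 / z ^ m = z powr (- real m)" using z by (simp add: powr_minus powr_realpow divide_inverse)
      \<comment> \<open>The base point has real part at most \<open>2\<close>, hence the loss of \<open>z ^ 2\<close>.\<close>
      also have "\<dots> \<le> z powr (2 - x)" using z m by (intro powr_mono) auto
      also have "\<dots> = z ^ 2 * z powr (- x)" using z by (simp add: powr_diff powr_minus divide_inverse)
      also have "\<dots> \<le> z ^ 2 * (norm b * z powr (- x))"
        using b1 z by (intro mult_left_mono) (auto simp: mult_le_cancel_right1)
      finally show ?thesis using mult_left_mono[of "1 / z ^ m" _ "\<bar>E\<bar>"] by (simp add: mult.assoc)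
    qed
    finally have first: "norm ((lerch_F ?z s a
        - (\<Sum>n<N. (\<Sum>k=0..n. of_nat m ^ k / fact k * coeff_C (n - k) ?z a) * P n)) / ?z ^ m)
          \<le> \<bar>E\<bar> * z ^ 2 * (norm b * z powr (- x))" .
    have "norm (\<Sum>j=1..m. 1 / ?z ^ j * (1 / (b - of_nat j) powr s - (\<Sum>n<N. of_nat j ^ n / fact n * P n)))
            \<le> (\<Sum>j=1..m. \<bar>C\<bar> * (real j ^ q / z ^ j) * x powr (1 - real N - Re s))"
    proof (rule sum_norm_le)
      fix j assume j: "j \<in> {1..m}"
      have "norm (1 / (b - of_nat j) powr s - (\<Sum>n<N. of_nat j ^ n / fact n * P n))
              \<le> C * real j ^ q * norm b powr (- real N - Re s)"
        unfolding P_def by (rule C) (use j m Reb in auto)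
      also have "\<dots> \<le> \<bar>C\<bar> * real j ^ q * x powr (1 - real N - Re s)"
      proof (intro mult_mono)
        have "norm b powr (- real N - Re s) \<le> x powr (- real N - Re s)"
          using nb x s by (intro powr_mono2') auto
        also have "\<dots> \<le> x powr (1 - real N - Re s)" using x by (intro powr_mono) auto
        finally show "norm b powr (- real N - Re s) \<le> x powr (1 - real N - Re s)" .
      qed auto
      finally have "norm (1 / ?z ^ j) * norm (1 / (b - of_nat j) powr s - (\<Sum>n<N. of_nat j ^ n / fact n * P n))
         \<le> 1 / z ^ j * (\<bar>C\<bar> * real j ^ q * x powr (1 - real N - Re s))"
        using z by (intro mult_mono) (auto simp: norm_divide norm_power)
      thus "norm (1 / ?z ^ j * (1 / (b - of_nat j) powr s - (\<Sum>n<N. of_nat j ^ n / fact n * P n)))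
         \<le> \<bar>C\<bar> * (real j ^ q / z ^ j) * x powr (1 - real N - Re s)"
        unfolding norm_mult by simp
    qed
    also have "\<dots> = \<bar>C\<bar> * (\<Sum>j=1..m. real j ^ q / z ^ j) * x powr (1 - real N - Re s)"
      by (simp add: sum_distrib_left sum_distrib_right)
    also have "\<dots> \<le> \<bar>C\<bar> * S * x powr (1 - real N - Re s)"
      unfolding S_def using z
      by (intro mult_right_mono mult_left_mono sum_le_suminf summable_power_times_geometric) auto
    finally have second: "norm (\<Sum>j=1..m. 1 / ?z ^ j * (1 / (b - of_nat j) powr s
            - (\<Sum>n<N. of_nat j ^ n / fact n * P n))) \<le> \<bar>C\<bar> * S * x powr (1 - real N - Re s)" .
    have "S \<ge> 0" unfolding S_def using z by (intro suminf_nonneg summable_power_times_geometric) auto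
    hence nonneg: "0 \<le> \<bar>C\<bar> * S * (norm b * z powr (- x))" "0 \<le> \<bar>E\<bar> * z ^ 2 * x powr (1 - real N - Re s)"
      by auto
    have "norm (remainder_R N ?z s b) \<le> \<bar>E\<bar> * z ^ 2 * (norm b * z powr (- x)) + \<bar>C\<bar> * S * x powr (1 - real N - Re s)"
      unfolding b_def remainder_R_shift[OF s Rea z'(1,3), of N m]
      unfolding b_def[symmetric] P_def[symmetric]
      by (rule order_trans[OF norm_triangle_ineq4 add_mono[OF first second]])
    also have "\<dots> \<le> (\<bar>C\<bar> * S + \<bar>E\<bar> * z ^ 2) * (x powr (1 - real N - Re s) + norm b * z powr (- x))"
      using nonneg by (simp add: algebra_simps)
    finally show ?thesis unfolding ax b_def .
  qed
  thus ?thesis by (intro exI[of _ "\<bar>C\<bar> * S + \<bar>E\<bar> * z ^ 2"] eventually_at_top_linorderI[of 3])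
qed

lemma lerch_F_of_nat:
  assumes s: "Re s > 0" and z: "z \<notin> \<real>\<^sub>\<le>\<^sub>0" and m: "m \<ge> 2"
  shows "lerch_F z s (of_nat m) = - (\<Sum>j=1..m-1. 1 / z ^ j * (1 / (of_nat m - of_nat j) powr s))"
proof -
  have "1 + of_nat (m - 1) = (of_nat m :: complex)" using m by (simp add: of_nat_diff)
  thus ?thesis
    using lerch_F_shift[OF s _ z, of 1 "m - 1"] lerch_F_eq[OF is_lerch_F_continuation_1[OF s] z] by simp
qed

text \<open>
  Both the coefficients and \<open>F\<close> are sums over \<open>j < m\<close>, and for each \<open>j\<close> the expansion is the binomial
  series of \<open>(1 - j / m) powr (- s)\<close>, which converges because \<open>j < m\<close>.
\<close>

lemma lerch_expansion_of_nat_sums: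
  assumes s: "Re s > 0" and z: "z \<notin> \<real>\<^sub>\<le>\<^sub>0" and m: "m \<ge> 2"
  shows "(\<lambda>n. coeff_C n z (of_nat m) * (pochhammer s n / of_nat m powr (of_nat n + s)))
           sums lerch_F z s (of_nat m)"
proof -
  have z0: "z \<noteq> 0" using z by auto
  have coeff: "coeff_C n z (of_nat m) = - (\<Sum>j=1..m-1. of_nat j ^ n / (z ^ j * fact n))" for n
    using coeff_C_of_nat[OF z0, of n "m - 1"] m by simp
  have "(\<lambda>n. of_nat j ^ n / (z ^ j * fact n) * (pochhammer s n / of_nat m powr (of_nat n + s)))
          sums (1 / z ^ j * (1 / (of_nat m - of_nat j) powr s))" if j: "j \<in> {1..m-1}" for j
  proof -
    let ?w = "of_nat j / of_nat m :: complex"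
    have jm: "j < m" using j m by auto
    hence "norm ?w < 1" by (simp add: norm_divide)
    hence "(\<lambda>n. 1 / z ^ j * (1 / of_nat m powr s) * (pochhammer s n / fact n * ?w ^ n))
             sums (1 / z ^ j * (1 / of_nat m powr s) * (1 / (1 - ?w) powr s))"
      by (intro sums_mult neg_binomial_sums)
    moreover have "(1 - ?w) powr s = (of_nat m - of_nat j) powr s / of_nat m powr s"
      using powr_divide_Re_pos[of "of_nat m" "of_nat m - of_nat j" s] jm
      by (simp add: diff_divide_distrib)
    moreover have "1 / z ^ j * (1 / of_nat m powr s) * (pochhammer s n / fact n * ?w ^ n) =
        of_nat j ^ n / (z ^ j * fact n) * (pochhammer s n / of_nat m powr (of_nat n + s))" for n
      using m by (simp add: powr_add power_divide ac_simps)
    ultimately show ?thesis using m by simp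
  qed
  hence "(\<lambda>n. \<Sum>j=1..m-1. of_nat j ^ n / (z ^ j * fact n) * (pochhammer s n / of_nat m powr (of_nat n + s)))
          sums (\<Sum>j=1..m-1. 1 / z ^ j * (1 / (of_nat m - of_nat j) powr s))"
    by (rule sums_sum)
  from sums_minus[OF this] show ?thesis
    unfolding coeff lerch_F_of_nat[OF assms] mult_minus_left sum_distrib_right .
qed

theorem theorem1:
  fixes s :: complex
  assumes "Re s > 0"
  shows "(\<forall>(N::nat) (z::real) (t::real). N \<ge> 1 \<longrightarrow> z > 1 \<longrightarrow>
           (\<exists>K::real. \<forall>\<^sub>F x in at_top.
              norm (remainder_R N (of_real z) s (Complex x t))
                \<le> K * (x powr (1 - real N - Re s) + norm (Complex x t) * z powr (- x)))) \<and>
         (\<forall>(z::real) (m::nat). z \<ge> 1 \<longrightarrow> m \<ge> 2 \<longrightarrow>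
           (\<lambda>N. remainder_R N (of_real z) s (of_nat m)) \<longlonglongrightarrow> 0 \<and>
           lerch_F (of_real z) s (of_nat m)
             = - (1 / of_real z ^ m) * (\<Sum>k=1..m-1. of_real z ^ k / of_nat k powr s) \<and>
           (\<lambda>n. coeff_C n (of_real z) (of_nat m) * (pochhammer s n / of_nat m powr (of_nat n + s)))
             sums lerch_F (of_real z) s (of_nat m))"
proof (intro conjI allI impI)
  fix N :: nat and z t :: real
  assume "z > 1"
  thus "\<exists>K::real. \<forall>\<^sub>F x in at_top. norm (remainder_R N (of_real z) s (Complex x t))
          \<le> K * (x powr (1 - real N - Re s) + norm (Complex x t) * z powr (- x))"
    by (rule remainder_R_bound[OF assms])
next
  fix z :: real and m :: nat
  assume z: "z \<ge> 1" and m: "m \<ge> 2"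
  let ?z = "complex_of_real z"
  have z': "?z \<notin> \<real>\<^sub>\<le>\<^sub>0" "?z \<noteq> 0" using z by (auto simp: complex_nonpos_Reals_iff)
  show sums: "(\<lambda>n. coeff_C n ?z (of_nat m) * (pochhammer s n / of_nat m powr (of_nat n + s)))
          sums lerch_F ?z s (of_nat m)"
    by (rule lerch_expansion_of_nat_sums[OF assms z'(1) m])
  show "(\<lambda>N. remainder_R N ?z s (of_nat m)) \<longlonglongrightarrow> 0"
    using tendsto_diff[OF tendsto_const sums[unfolded sums_def], of "lerch_F ?z s (of_nat m)"]
    by (simp add: remainder_R_def[abs_def])
  have "(\<Sum>j=1..m-1. 1 / ?z ^ j * (1 / (of_nat m - of_nat j) powr s)) =
          (\<Sum>k=1..m-1. 1 / ?z ^ m * (?z ^ k / of_nat k powr s))"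
    by (rule sum.reindex_bij_witness[of _ "\<lambda>k. m - k" "\<lambda>j. m - j"])
       (use z'(2) in \<open>auto simp: of_nat_diff power_diff field_simps\<close>)
  thus "lerch_F ?z s (of_nat m) = - (1 / ?z ^ m) * (\<Sum>k=1..m-1. ?z ^ k / of_nat k powr s)"
    unfolding lerch_F_of_nat[OF assms z'(1) m] sum_distrib_left[symmetric] by simp
qed

end
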